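(* Let $(\eta,\overline{\boldsymbol u})$ be a sufficiently regular spatially periodic solution on the periodic cell $S_H$ of the location-uncertainty (LU) Saint-Venant model defined in the context. Assume that the depth-averaged horizontal noise vanishes on $\partial S_H$ and that the depth-averaged horizontal noise and Itô-Stokes drift are divergence free: $$\nabla_H\cdot\overline{\boldsymbol\sigma\circ\mathrm d\boldsymbol B_t^H}=0,\qquad \nabla_H\cdot\overline{\boldsymbol u}_s=0 .$$ Then, pathwise, the energy $$E_{SW}=\frac{\epsilon^2}{2}\int_{S_H}h\,\|\overline{\boldsymbol u}\|^2\,\mathrm dS_H+\frac12\int_{S_H}h^2\,\mathrm dS_H,\qquad h=1+\epsilon\eta,$$ is conserved: $\mathrm d_tE_{SW}=0$.
   Context: Let $d\in\{1,2\}$ and let $S_H\subset\mathbb R^d$ be a bounded interval ($d=1$) or rectangle ($d=2$), regarded as a periodic cell: all fields below and their spatial derivatives satisfy periodic boundary conditions on $\partial S_H$. $\nabla_H$ and $\nabla_H\cdot$ are the gradient and divergence in the horizontal variables. The parameters $\epsilon,\Upsilon>0$ are constants. All quantities are nondimensional. Work on a filtered probability space carrying independent standard one-dimensional Brownian motions $(\beta^n)_n$. The unknowns are the surface elevation $\eta(\boldsymbol x,t)\in\mathbb R$ and the depth-averaged horizontal velocity $\overline{\boldsymbol u}(\boldsymbol x,t)\in\mathbb R^d$; the water depth is $h=1+\epsilon\eta$, assumed positive. The depth-averaged Itô-Stokes drift $\overline{\boldsymbol u}_s(\boldsymbol x,t)\in\mathbb R^d$ is a periodic field. The depth-averaged horizontal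 noise is $\overline{\boldsymbol\sigma\circ\mathrm d\boldsymbol B_t^H}=\sum_n\boldsymbol\varphi_n(\boldsymbol x,t)\circ\mathrm d\beta^n_t$ with $\mathbb R^d$-valued spatially periodic fields $\boldsymbol\varphi_n$ (Stratonovich sense). "The noise vanishes on $\partial S_H$" means that every $\boldsymbol\varphi_n$ vanishes there, and "the noise is divergence free" means $\nabla_H\cdot\boldsymbol\varphi_n=0$ for every $n$. Set $\overline{\boldsymbol u}^*=\overline{\boldsymbol u}-\tfrac12\Upsilon\epsilon\,\overline{\boldsymbol u}_s$. All stochastic differentials and products of processes with stochastic differentials are in the Stratonovich sense, $\mathrm d_t$ denotes the time differential at fixed $\boldsymbol x$ (or of a space-independent process), and for a scalar or vector field $f$ $$\overline D^H_t f=\mathrm d_t f+\epsilon(\overline{\boldsymbol u}^*\cdot\nabla_H)f\,\mathrm dt+\Upsilon^{1/2}\epsilon\,(\overline{\boldsymbol\sigma\circ\mathrm d\boldsymbol B_t^H}\cdot\nabla_H)f .$$ The LU Saint-Venant (shallow water) model is the system $$\overline D^H_t\eta=-h\big(\nabla_H\cdot\overline{\boldsymbol u}^*\,\mathrm dt+\Upsilon^{1/2}\nabla_H\cdot\overline{\boldsymbol\sigma\circ\mathrm d\boldsymbol B_t^H}\big),\qquad \overline D^H_t\overline{\boldsymbol u}+\nabla_H\eta\,\mathrm dt=0 .$$ "Sufficiently regular" means: $\eta,\overline{\boldsymbol u}$ are continuous semimartingales in time with values in spatially smooth periodic fields, the coefficients $\overline{\boldsymbol u}_s,\boldsymbol\varphi_n$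 are smooth in space and are such that all sums and Stratonovich integrals converge, and the Stratonovich product rule, spatial differentiation and integration over $S_H$ may be applied to and interchanged with the stochastic differentials. *)

theory Defs
  imports "HOL-Probability.Probability"
begin

section \<open>Horizontal calculus on a periodic cell\<close>

definition pd :: "'d::finite \<Rightarrow> (real^'d \<Rightarrow> real) \<Rightarrow> real^'d \<Rightarrow> real" where
  "pd i f x = frechet_derivative f (at x) (axis i 1)"

definition grad :: "(real^'d::finite \<Rightarrow> real) \<Rightarrow> real^'d \<Rightarrow> real^'d" where
  "grad f x = (\<chi> i. pd i f x)"

definition divergence :: "(real^'d::finite \<Rightarrow> real^'d) \<Rightarrow> real^'d \<Rightarrow> real" where
  "divergence v x = (\<Sum>i\<in>UNIV. pd i (\<lambda>y. v y $ i) x)"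

fun iter_pd :: "'d::finite list \<Rightarrow> (real^'d \<Rightarrow> real) \<Rightarrow> real^'d \<Rightarrow> real" where
  "iter_pd [] f = f"
| "iter_pd (i # is) f = pd i (iter_pd is f)"

definition smooth :: "(real^'d::finite \<Rightarrow> real) \<Rightarrow> bool" where
  "smooth f \<longleftrightarrow> (\<forall>is x. iter_pd is f differentiable (at x))"

text \<open>A smooth field on the cell \<open>cbox a b\<close> that satisfies periodic boundary conditions together
  with all its derivatives is represented by its periodic extension to the whole space.\<close>

definition periodic :: "real^'d::finite \<Rightarrow> real^'d \<Rightarrow> (real^'d \<Rightarrow> real) \<Rightarrow> bool" where
  "periodic a b f \<longleftrightarrow> (\<forall>x i. f (x + axis i (b $ i - a $ i)) = f x)"

definition smooth_periodic :: "real^'d::finite \<Rightarrow> real^'d \<Rightarrow> (real^'d \<Rightarrow> real) \<Rightarrow> bool" where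
  "smooth_periodic a b f \<longleftrightarrow> smooth f \<and> periodic a b f"


section \<open>Stochastic processes\<close>

text \<open>Random fields: time, sample point, horizontal position.\<close>

type_synonym 'w process = "real \<Rightarrow> 'w \<Rightarrow> real"
type_synonym ('w, 'd) field = "real \<Rightarrow> 'w \<Rightarrow> real^'d \<Rightarrow> real"
type_synonym ('w, 'd) vfield = "real \<Rightarrow> 'w \<Rightarrow> real^'d \<Rightarrow> real^'d"

definition filtered_prob_space :: "'w measure \<Rightarrow> (real \<Rightarrow> 'w measure) \<Rightarrow> bool" where
  "filtered_prob_space M F \<longleftrightarrow>
     prob_space M \<and> filtration (space M) F \<and> (\<forall>t. subalgebra M (F t))"

definition brownian_motion :: "'w measure \<Rightarrow> (real \<Rightarrow> 'w measure) \<Rightarrow> 'w process \<Rightarrow> bool" where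
  "brownian_motion M F B \<longleftrightarrow>
     (\<forall>t\<ge>0. B t \<in> borel_measurable (F t)) \<and>
     (AE \<omega> in M. B 0 \<omega> = 0) \<and>
     (\<forall>\<omega>\<in>space M. continuous_on {0..} (\<lambda>t. B t \<omega>)) \<and>
     (\<forall>s t. 0 \<le> s \<longrightarrow> s < t \<longrightarrow>
        distributed M lborel (\<lambda>\<omega>. B t \<omega> - B s \<omega>) (normal_density 0 (sqrt (t - s))) \<and>
        prob_space.indep_set M (sets (F s))
          {(\<lambda>\<omega>. B t \<omega> - B s \<omega>) -` A \<inter> space M | A. A \<in> sets borel})"

definition independent_brownian_motions ::
    "'w measure \<Rightarrow> (real \<Rightarrow> 'w measure) \<Rightarrow> (nat \<Rightarrow> 'w process) \<Rightarrow> bool" where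
  "independent_brownian_motions M F \<beta> \<longleftrightarrow>
     (\<forall>n. brownian_motion M F (\<beta> n)) \<and>
     prob_space.indep_vars M (\<lambda>_. PiM {0..} (\<lambda>_. borel)) (\<lambda>n \<omega>. \<lambda>t\<in>{0..}. \<beta> n t \<omega>) UNIV"

text \<open>\<open>p 0 \<le> p 1 \<le> \<dots> \<le> p m\<close> is a partition of \<open>[0, t]\<close>.\<close>

definition is_partition :: "real \<Rightarrow> nat \<Rightarrow> (nat \<Rightarrow> real) \<Rightarrow> bool" where
  "is_partition t m p \<longleftrightarrow> p 0 = 0 \<and> p m = t \<and> (\<forall>i<m. p i \<le> p (Suc i))"

text \<open>In the following notions \<open>I\<close> is the time interval on which the process lives; it is
  \<open>[0, \<infinity>)\<close>, \<open>[0, T]\<close> or \<open>[0, T)\<close>.\<close>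

definition martingale_on ::
    "'w measure \<Rightarrow> (real \<Rightarrow> 'w measure) \<Rightarrow> real set \<Rightarrow> 'w process \<Rightarrow> bool" where
  "martingale_on M F I X \<longleftrightarrow>
     (\<forall>t\<in>I. X t \<in> borel_measurable (F t) \<and> integrable M (X t)) \<and>
     (\<forall>s\<in>I. \<forall>t\<in>I. s \<le> t \<longrightarrow> (AE \<omega> in M. real_cond_exp M (F s) (X t) \<omega> = X s \<omega>))"

text \<open>Real-valued localizing times suffice: an extended-valued time \<open>\<tau>\<^sub>n\<close> may be replaced by
  \<open>min \<tau>\<^sub>n n\<close>.\<close>

definition continuous_local_martingale ::
    "'w measure \<Rightarrow> (real \<Rightarrow> 'w measure) \<Rightarrow> real set \<Rightarrow> 'w process \<Rightarrow> bool" where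
  "continuous_local_martingale M F I X \<longleftrightarrow>
     (\<forall>t\<in>I. X t \<in> borel_measurable (F t)) \<and>
     (AE \<omega> in M. continuous_on I (\<lambda>t. X t \<omega>)) \<and>
     (\<exists>\<tau>. (\<forall>n. stopping_time F (\<tau> n) \<and> (\<forall>\<omega>\<in>space M. 0 \<le> \<tau> n \<omega>)) \<and>
        (AE \<omega> in M. incseq (\<lambda>n. \<tau> n \<omega>) \<and> (\<forall>t\<in>I. \<forall>\<^sub>F n in sequentially. t \<le> \<tau> n \<omega>)) \<and>
        (\<forall>n. martingale_on M F I (\<lambda>t \<omega>. X (min t (\<tau> n \<omega>)) \<omega> - X 0 \<omega>)))"

definition continuous_finite_variation ::
    "'w measure \<Rightarrow> (real \<Rightarrow> 'w measure) \<Rightarrow> real set \<Rightarrow> 'w process \<Rightarrow> bool" where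
  "continuous_finite_variation M F I A \<longleftrightarrow>
     (\<forall>t\<in>I. A t \<in> borel_measurable (F t)) \<and>
     (AE \<omega> in M. continuous_on I (\<lambda>t. A t \<omega>) \<and>
        (\<forall>t\<in>I. \<exists>C. \<forall>m p. is_partition t m p \<longrightarrow>
            (\<Sum>i<m. \<bar>A (p (Suc i)) \<omega> - A (p i) \<omega>\<bar>) \<le> C))"

definition continuous_semimartingale ::
    "'w measure \<Rightarrow> (real \<Rightarrow> 'w measure) \<Rightarrow> real set \<Rightarrow> 'w process \<Rightarrow> bool" where
  "continuous_semimartingale M F I X \<longleftrightarrow>
     (\<forall>t\<in>I. X t \<in> borel_measurable (F t)) \<and>
     (\<forall>\<omega>\<in>space M. continuous_on I (\<lambda>t. X t \<omega>)) \<and>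
     (\<exists>N A. continuous_local_martingale M F I N \<and> continuous_finite_variation M F I A \<and>
        (AE \<omega> in M. \<forall>t\<in>I. X t \<omega> = N t \<omega> + A t \<omega>))"

text \<open>A semimartingale with values in the smooth periodic fields: continuity in time is with
  respect to the topology of uniform convergence of all spatial derivatives, and every evaluation
  of a spatial derivative is a real semimartingale.\<close>

definition smooth_semimartingale_field ::
    "'w measure \<Rightarrow> (real \<Rightarrow> 'w measure) \<Rightarrow> real set \<Rightarrow> real^'d::finite \<Rightarrow> real^'d
      \<Rightarrow> ('w, 'd) field \<Rightarrow> bool" where
  "smooth_semimartingale_field M F I a b f \<longleftrightarrow>
     (\<forall>t\<in>I. \<forall>\<omega>\<in>space M. smooth_periodic a b (f t \<omega>)) \<and>
     (\<forall>is. \<forall>\<omega>\<in>space M. continuous_on (I \<times> UNIV) (\<lambda>(t, x). iter_pd is (f t \<omega>) x)) \<and>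
     (\<forall>is x. continuous_semimartingale M F I (\<lambda>t \<omega>. iter_pd is (f t \<omega>) x))"


section \<open>Stratonovich integrals and differentials\<close>

text \<open>Measurability is demanded explicitly because \<^const>\<open>measure\<close> is 0 on non-measurable sets.\<close>

definition conv_in_prob :: "'w measure \<Rightarrow> (nat \<Rightarrow> 'w \<Rightarrow> real) \<Rightarrow> ('w \<Rightarrow> real) \<Rightarrow> bool" where
  "conv_in_prob M X Y \<longleftrightarrow>
     (\<forall>n. X n \<in> borel_measurable M) \<and> Y \<in> borel_measurable M \<and>
     (\<forall>e>0. (\<lambda>n. measure M {\<omega>\<in>space M. \<bar>X n \<omega> - Y \<omega>\<bar> > e}) \<longlonglongrightarrow> 0)"

definition strat_sum :: "'w process \<Rightarrow> 'w process \<Rightarrow> nat \<Rightarrow> (nat \<Rightarrow> real) \<Rightarrow> 'w \<Rightarrow> real" where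
  "strat_sum Y X m p \<omega> =
     (\<Sum>i<m. (Y (p i) \<omega> + Y (p (Suc i)) \<omega>) / 2 * (X (p (Suc i)) \<omega> - X (p i) \<omega>))"

text \<open>\<open>J\<close> is the Stratonovich integral of \<open>Y\<close> against \<open>X\<close> over \<open>[0, t]\<close>: the limit in
  probability of the trapezoidal sums along all partitions with mesh tending to 0.\<close>

definition has_strat_integral ::
    "'w measure \<Rightarrow> 'w process \<Rightarrow> 'w process \<Rightarrow> real \<Rightarrow> ('w \<Rightarrow> real) \<Rightarrow> bool" where
  "has_strat_integral M Y X t J \<longleftrightarrow>
     (\<forall>m p. (\<forall>k. is_partition t (m k) (p k)) \<longrightarrow>
        (\<forall>\<delta>>0. \<forall>\<^sub>F k in sequentially. \<forall>i<m k. p k (Suc i) - p k i < \<delta>) \<longrightarrow>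
        conv_in_prob M (\<lambda>k. strat_sum Y X (m k) (p k)) J)"

text \<open>\<open>S = \<Sum>\<^sub>n \<integral>\<^sub>0\<^sup>t y\<^sub>n \<circ> d\<beta>\<^sub>n\<close>, the series converging in probability.\<close>

definition has_noise_integral ::
    "'w measure \<Rightarrow> (nat \<Rightarrow> 'w process) \<Rightarrow> (nat \<Rightarrow> 'w process) \<Rightarrow> real \<Rightarrow> ('w \<Rightarrow> real) \<Rightarrow> bool" where
  "has_noise_integral M \<beta> y t S \<longleftrightarrow>
     (\<exists>J. (\<forall>n. has_strat_integral M (y n) (\<beta> n) t (J n)) \<and>
          conv_in_prob M (\<lambda>N \<omega>. \<Sum>n<N. J n \<omega>) S)"

text \<open>\<open>d\<^sub>t X + r dt + \<Sum>\<^sub>n y\<^sub>n \<circ> d\<beta>\<^sub>n = r' dt + \<Sum>\<^sub>n y'\<^sub>n \<circ> d\<beta>\<^sub>n\<close> on the time interval \<open>I\<close>, in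
  integrated form; all the integrals and sums are required to exist.\<close>

definition strat_equation ::
    "'w measure \<Rightarrow> (nat \<Rightarrow> 'w process) \<Rightarrow> real set \<Rightarrow> 'w process
      \<Rightarrow> 'w process \<Rightarrow> (nat \<Rightarrow> 'w process) \<Rightarrow> 'w process \<Rightarrow> (nat \<Rightarrow> 'w process) \<Rightarrow> bool" where
  "strat_equation M \<beta> I X r y r' y' \<longleftrightarrow>
     (\<forall>t\<in>I. \<exists>S S'. has_noise_integral M \<beta> y t S \<and> has_noise_integral M \<beta> y' t S' \<and>
        (AE \<omega> in M.
           set_integrable lborel {0..t} (\<lambda>s. r s \<omega>) \<and>
           set_integrable lborel {0..t} (\<lambda>s. r' s \<omega>) \<and>
           X t \<omega> - X 0 \<omega> + (LINT s:{0..t}|lborel. r s \<omega>) + S \<omega>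
             = (LINT s:{0..t}|lborel. r' s \<omega>) + S' \<omega>))"

text \<open>\<open>d\<^sub>t X = r dt + \<Sum>\<^sub>n y\<^sub>n \<circ> d\<beta>\<^sub>n\<close>.\<close>

definition has_strat_differential ::
    "'w measure \<Rightarrow> (nat \<Rightarrow> 'w process) \<Rightarrow> real set \<Rightarrow> 'w process
      \<Rightarrow> 'w process \<Rightarrow> (nat \<Rightarrow> 'w process) \<Rightarrow> bool" where
  "has_strat_differential M \<beta> I X r y \<longleftrightarrow>
     (\<forall>t\<in>I. \<exists>S. has_noise_integral M \<beta> y t S \<and>
        (AE \<omega> in M.
           set_integrable lborel {0..t} (\<lambda>s. r s \<omega>) \<and>
           X t \<omega> - X 0 \<omega> = (LINT s:{0..t}|lborel. r s \<omega>) + S \<omega>))"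


section \<open>The location-uncertainty Saint-Venant model\<close>

definition ustar :: "real \<Rightarrow> real \<Rightarrow> ('w, 'd::finite) vfield \<Rightarrow> ('w, 'd) vfield \<Rightarrow> ('w, 'd) vfield" where
  "ustar \<epsilon> \<Upsilon> us u t \<omega> x = u t \<omega> x - (\<Upsilon> * \<epsilon> / 2) *\<^sub>R us t \<omega> x"

definition depth :: "real \<Rightarrow> ('w, 'd::finite) field \<Rightarrow> ('w, 'd) field" where
  "depth \<epsilon> \<eta> t \<omega> x = 1 + \<epsilon> * \<eta> t \<omega> x"

definition advect :: "('w, 'd::finite) vfield \<Rightarrow> ('w, 'd) field \<Rightarrow> ('w, 'd) field" where
  "advect v f t \<omega> x = v t \<omega> x \<bullet> grad (f t \<omega>) x"

definition vcomp :: "'d::finite \<Rightarrow> ('w, 'd) vfield \<Rightarrow> ('w, 'd) field" where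
  "vcomp i v t \<omega> x = v t \<omega> x $ i"

text \<open>The transport equation \<open>D\<^sub>t f = r dt + \<Sum>\<^sub>n y\<^sub>n \<circ> d\<beta>\<^sub>n\<close> at every position, where
  \<open>D\<^sub>t f = d\<^sub>t f + \<epsilon> (v \<bullet> \<nabla>) f dt + sqrt \<Upsilon> \<epsilon> \<Sum>\<^sub>n (\<phi>\<^sub>n \<bullet> \<nabla>) f \<circ> d\<beta>\<^sub>n\<close>.\<close>

definition stoch_transport ::
    "'w measure \<Rightarrow> (nat \<Rightarrow> 'w process) \<Rightarrow> real set \<Rightarrow> real \<Rightarrow> real \<Rightarrow> ('w, 'd::finite) vfield
      \<Rightarrow> (nat \<Rightarrow> ('w, 'd) vfield) \<Rightarrow> ('w, 'd) field
      \<Rightarrow> ('w, 'd) field \<Rightarrow> (nat \<Rightarrow> ('w, 'd) field) \<Rightarrow> bool" where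
  "stoch_transport M \<beta> I \<epsilon> \<Upsilon> v \<phi> f r y \<longleftrightarrow>
     (\<forall>x. strat_equation M \<beta> I (\<lambda>t \<omega>. f t \<omega> x)
        (\<lambda>t \<omega>. \<epsilon> * advect v f t \<omega> x) (\<lambda>n t \<omega>. sqrt \<Upsilon> * \<epsilon> * advect (\<phi> n) f t \<omega> x)
        (\<lambda>t \<omega>. r t \<omega> x) (\<lambda>n t \<omega>. y n t \<omega> x))"

definition mass_drift ::
    "real \<Rightarrow> real \<Rightarrow> ('w, 'd::finite) vfield \<Rightarrow> ('w, 'd) field \<Rightarrow> ('w, 'd) vfield \<Rightarrow> ('w, 'd) field" where
  "mass_drift \<epsilon> \<Upsilon> us \<eta> u t \<omega> x = - (depth \<epsilon> \<eta> t \<omega> x * divergence (ustar \<epsilon> \<Upsilon> us u t \<omega>) x)"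

definition mass_noise ::
    "real \<Rightarrow> real \<Rightarrow> (nat \<Rightarrow> ('w, 'd::finite) vfield) \<Rightarrow> ('w, 'd) field \<Rightarrow> nat \<Rightarrow> ('w, 'd) field" where
  "mass_noise \<epsilon> \<Upsilon> \<phi> \<eta> n t \<omega> x = - (depth \<epsilon> \<eta> t \<omega> x * (sqrt \<Upsilon> * divergence (\<phi> n t \<omega>) x))"

definition LU_saint_venant ::
    "'w measure \<Rightarrow> (nat \<Rightarrow> 'w process) \<Rightarrow> real set \<Rightarrow> real \<Rightarrow> real \<Rightarrow> ('w, 'd::finite) vfield
      \<Rightarrow> (nat \<Rightarrow> ('w, 'd) vfield) \<Rightarrow> ('w, 'd) field \<Rightarrow> ('w, 'd) vfield \<Rightarrow> bool" where
  "LU_saint_venant M \<beta> I \<epsilon> \<Upsilon> us \<phi> \<eta> u \<longleftrightarrow>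
     stoch_transport M \<beta> I \<epsilon> \<Upsilon> (ustar \<epsilon> \<Upsilon> us u) \<phi> \<eta>
       (mass_drift \<epsilon> \<Upsilon> us \<eta> u) (mass_noise \<epsilon> \<Upsilon> \<phi> \<eta>) \<and>
     (\<forall>i. stoch_transport M \<beta> I \<epsilon> \<Upsilon> (ustar \<epsilon> \<Upsilon> us u) \<phi> (vcomp i u)
       (\<lambda>t \<omega> x. - pd i (\<eta> t \<omega>) x) (\<lambda>n t \<omega> x. 0))"

definition SW_energy ::
    "real^'d::finite \<Rightarrow> real^'d \<Rightarrow> real \<Rightarrow> ('w, 'd) field \<Rightarrow> ('w, 'd) vfield \<Rightarrow> 'w process" where
  "SW_energy a b \<epsilon> \<eta> u t \<omega> =
     \<epsilon>\<^sup>2 / 2 * (LINT x:cbox a b|lborel. depth \<epsilon> \<eta> t \<omega> x * (norm (u t \<omega> x))\<^sup>2)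
     + 1 / 2 * (LINT x:cbox a b|lborel. (depth \<epsilon> \<eta> t \<omega> x)\<^sup>2)"


section \<open>Sufficient regularity\<close>

text \<open>A triple \<open>(X, r, y)\<close> stands for the formal field differential
  \<open>d\<^sub>t X = r dt + \<Sum>\<^sub>n y\<^sub>n \<circ> d\<beta>\<^sub>n\<close>.\<close>

type_synonym ('w, 'd) fdiff = "('w, 'd) field \<times> ('w, 'd) field \<times> (nat \<Rightarrow> ('w, 'd) field)"

definition valid_fdiff ::
    "'w measure \<Rightarrow> (nat \<Rightarrow> 'w process) \<Rightarrow> real set \<Rightarrow> ('w, 'd::finite) fdiff \<Rightarrow> bool" where
  "valid_fdiff M \<beta> I = (\<lambda>(X, r, y). \<forall>x.
     has_strat_differential M \<beta> I (\<lambda>t \<omega>. X t \<omega> x) (\<lambda>t \<omega>. r t \<omega> x) (\<lambda>n t \<omega>. y n t \<omega> x))"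

definition valid_integrated_fdiff ::
    "'w measure \<Rightarrow> (nat \<Rightarrow> 'w process) \<Rightarrow> real set \<Rightarrow> real^'d::finite \<Rightarrow> real^'d
      \<Rightarrow> ('w, 'd) fdiff \<Rightarrow> bool" where
  "valid_integrated_fdiff M \<beta> I a b = (\<lambda>(X, r, y).
     has_strat_differential M \<beta> I (\<lambda>t \<omega>. LINT x:cbox a b|lborel. X t \<omega> x)
       (\<lambda>t \<omega>. LINT x:cbox a b|lborel. r t \<omega> x)
       (\<lambda>n t \<omega>. LINT x:cbox a b|lborel. y n t \<omega> x))"

fun add_fdiff :: "('w, 'd::finite) fdiff \<Rightarrow> ('w, 'd) fdiff \<Rightarrow> ('w, 'd) fdiff" where
  "add_fdiff (X, r, y) (X', r', y') =
     ((\<lambda>t \<omega> x. X t \<omega> x + X' t \<omega> x),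
      (\<lambda>t \<omega> x. r t \<omega> x + r' t \<omega> x),
      (\<lambda>n t \<omega> x. y n t \<omega> x + y' n t \<omega> x))"

text \<open>The Stratonovich product rule \<open>d(X X') = X \<circ> dX' + X' \<circ> dX\<close>, expanded.\<close>

fun mult_fdiff :: "('w, 'd::finite) fdiff \<Rightarrow> ('w, 'd) fdiff \<Rightarrow> ('w, 'd) fdiff" where
  "mult_fdiff (X, r, y) (X', r', y') =
     ((\<lambda>t \<omega> x. X t \<omega> x * X' t \<omega> x),
      (\<lambda>t \<omega> x. X t \<omega> x * r' t \<omega> x + X' t \<omega> x * r t \<omega> x),
      (\<lambda>n t \<omega> x. X t \<omega> x * y' n t \<omega> x + X' t \<omega> x * y n t \<omega> x))"

fun pd_fdiff :: "'d::finite \<Rightarrow> ('w, 'd) fdiff \<Rightarrow> ('w, 'd) fdiff" where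
  "pd_fdiff i (X, r, y) =
     ((\<lambda>t \<omega>. pd i (X t \<omega>)), (\<lambda>t \<omega>. pd i (r t \<omega>)), (\<lambda>n t \<omega>. pd i (y n t \<omega>)))"

text \<open>The differential of \<open>f\<close> obtained by solving \<open>D\<^sub>t f = r dt + \<Sum>\<^sub>n y\<^sub>n \<circ> d\<beta>\<^sub>n\<close> for \<open>d\<^sub>t f\<close>.\<close>

definition transport_fdiff ::
    "real \<Rightarrow> real \<Rightarrow> ('w, 'd::finite) vfield \<Rightarrow> (nat \<Rightarrow> ('w, 'd) vfield) \<Rightarrow> ('w, 'd) field
      \<Rightarrow> ('w, 'd) field \<Rightarrow> (nat \<Rightarrow> ('w, 'd) field) \<Rightarrow> ('w, 'd) fdiff" where
  "transport_fdiff \<epsilon> \<Upsilon> v \<phi> f r y =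
     (f,
      (\<lambda>t \<omega> x. r t \<omega> x - \<epsilon> * advect v f t \<omega> x),
      (\<lambda>n t \<omega> x. y n t \<omega> x - sqrt \<Upsilon> * \<epsilon> * advect (\<phi> n) f t \<omega> x))"

text \<open>The field differentials generated by the unknowns: \<open>d\<^sub>t \<eta>\<close>, \<open>d\<^sub>t u\<^sub>i\<close> and those of the
  differential polynomials in \<open>\<eta>\<close> and \<open>u\<close>.\<close>

inductive_set generated_fdiffs ::
    "real \<Rightarrow> real \<Rightarrow> ('w, 'd::finite) vfield \<Rightarrow> (nat \<Rightarrow> ('w, 'd) vfield)
      \<Rightarrow> ('w, 'd) field \<Rightarrow> ('w, 'd) vfield \<Rightarrow> ('w, 'd) fdiff set"
  for \<epsilon> \<Upsilon> us \<phi> \<eta> u where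
  const: "((\<lambda>t \<omega> x. c), (\<lambda>t \<omega> x. 0), (\<lambda>n t \<omega> x. 0)) \<in> generated_fdiffs \<epsilon> \<Upsilon> us \<phi> \<eta> u"
| elevation: "transport_fdiff \<epsilon> \<Upsilon> (ustar \<epsilon> \<Upsilon> us u) \<phi> \<eta>
      (mass_drift \<epsilon> \<Upsilon> us \<eta> u) (mass_noise \<epsilon> \<Upsilon> \<phi> \<eta>) \<in> generated_fdiffs \<epsilon> \<Upsilon> us \<phi> \<eta> u"
| velocity: "transport_fdiff \<epsilon> \<Upsilon> (ustar \<epsilon> \<Upsilon> us u) \<phi> (vcomp i u)
      (\<lambda>t \<omega> x. - pd i (\<eta> t \<omega>) x) (\<lambda>n t \<omega> x. 0) \<in> generated_fdiffs \<epsilon> \<Upsilon> us \<phi> \<eta> u"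
| add: "D \<in> generated_fdiffs \<epsilon> \<Upsilon> us \<phi> \<eta> u \<Longrightarrow> D' \<in> generated_fdiffs \<epsilon> \<Upsilon> us \<phi> \<eta> u
      \<Longrightarrow> add_fdiff D D' \<in> generated_fdiffs \<epsilon> \<Upsilon> us \<phi> \<eta> u"
| mult: "D \<in> generated_fdiffs \<epsilon> \<Upsilon> us \<phi> \<eta> u \<Longrightarrow> D' \<in> generated_fdiffs \<epsilon> \<Upsilon> us \<phi> \<eta> u
      \<Longrightarrow> mult_fdiff D D' \<in> generated_fdiffs \<epsilon> \<Upsilon> us \<phi> \<eta> u"
| pd: "D \<in> generated_fdiffs \<epsilon> \<Upsilon> us \<phi> \<eta> u
      \<Longrightarrow> pd_fdiff i D \<in> generated_fdiffs \<epsilon> \<Upsilon> us \<phi> \<eta> u"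

text \<open>The Stratonovich product rule, spatial differentiation and integration over the cell may be
  applied to, and interchanged with, the stochastic differentials in the class \<open>G\<close>.\<close>

definition strat_calculus_applies ::
    "'w measure \<Rightarrow> (nat \<Rightarrow> 'w process) \<Rightarrow> real set \<Rightarrow> real^'d::finite \<Rightarrow> real^'d
      \<Rightarrow> ('w, 'd) fdiff set \<Rightarrow> bool" where
  "strat_calculus_applies M \<beta> I a b G \<longleftrightarrow>
     (\<forall>D\<in>G. \<forall>D'\<in>G. valid_fdiff M \<beta> I D \<longrightarrow> valid_fdiff M \<beta> I D'
        \<longrightarrow> valid_fdiff M \<beta> I (mult_fdiff D D')) \<and>
     (\<forall>D\<in>G. \<forall>i. valid_fdiff M \<beta> I D \<longrightarrow> valid_fdiff M \<beta> I (pd_fdiff i D)) \<and>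
     (\<forall>D\<in>G. valid_fdiff M \<beta> I D \<longrightarrow> valid_integrated_fdiff M \<beta> I a b D)"

text \<open>Convergence of the sums and Stratonovich integrals in the model equations is part of
  \<^const>\<open>strat_equation\<close>; here convergence of the noise itself is recorded.\<close>

definition sufficiently_regular ::
    "'w measure \<Rightarrow> (real \<Rightarrow> 'w measure) \<Rightarrow> (nat \<Rightarrow> 'w process) \<Rightarrow> real set
      \<Rightarrow> real^'d::finite \<Rightarrow> real^'d \<Rightarrow> real \<Rightarrow> real \<Rightarrow> ('w, 'd) vfield
      \<Rightarrow> (nat \<Rightarrow> ('w, 'd) vfield) \<Rightarrow> ('w, 'd) field \<Rightarrow> ('w, 'd) vfield \<Rightarrow> bool" where
  "sufficiently_regular M F \<beta> I a b \<epsilon> \<Upsilon> us \<phi> \<eta> u \<longleftrightarrow>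
     smooth_semimartingale_field M F I a b \<eta> \<and>
     (\<forall>i. smooth_semimartingale_field M F I a b (vcomp i u)) \<and>
     (\<forall>t\<in>I. \<forall>\<omega>\<in>space M. \<forall>i. smooth_periodic a b (vcomp i us t \<omega>)) \<and>
     (\<forall>n. \<forall>t\<in>I. \<forall>\<omega>\<in>space M. \<forall>i. smooth_periodic a b (vcomp i (\<phi> n) t \<omega>)) \<and>
     (\<forall>x i. \<forall>t\<in>I. \<exists>S. has_noise_integral M \<beta> (\<lambda>n s \<omega>. \<phi> n s \<omega> x $ i) t S) \<and>
     strat_calculus_applies M \<beta> I a b (generated_fdiffs \<epsilon> \<Upsilon> us \<phi> \<eta> u)"

end

theory Submission
  imports Defs
begin

text \<open>
  Write \<open>z\<close> for the elevation, \<open>U\<close> for the velocity, \<open>V = U - (\<Upsilon> \<epsilon> / 2) u\<^sub>s\<close> for the effective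
  transport velocity and \<open>h = 1 + \<epsilon> z\<close>. The Stratonovich integral obeys the ordinary product rule,
  so the energy density \<open>e = \<epsilon>\<^sup>2/2 h |U|\<^sup>2 + h\<^sup>2/2\<close> has a differential whose coefficients are the
  first variation of \<open>e\<close> along the coefficients of \<open>d z\<close> and \<open>d U\<close>. Both kinds of coefficient are
  divergences. As \<open>u\<^sub>s\<close> is divergence free, \<open>div V = div U\<close>, and the drift is
  \<open>- \<epsilon> div (e V + h\<^sup>2/2 U)\<close>: transport of the energy and work of the pressure
  (\<open>energy_drift_is_divergence\<close>). As \<open>\<phi>\<^sub>n\<close> is divergence free, the \<open>n\<close>-th noise coefficient is
  \<open>- sqrt \<Upsilon> \<epsilon> div (e \<phi>\<^sub>n)\<close> (\<open>energy_noise_is_divergence\<close>).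

  The divergence of a periodic field integrates to zero over the cell
  (\<open>integral_divergence_periodic\<close>). Hence the integrated energy has a differential with zero
  coefficients, so at each fixed time it almost surely equals its initial value
  (\<open>has_strat_differential_zero\<close>). It is continuous in time, so one null set serves all times
  (\<open>AE_constant_on_interval\<close>).
\<close>


section \<open>Linearity of stochastic differentials\<close>

lemma conv_in_prob_lincomb:
  assumes M: "finite_measure M"
    and X: "conv_in_prob M X Y" and X': "conv_in_prob M X' Y'"
  shows "conv_in_prob M (\<lambda>n \<omega>. X n \<omega> + c * X' n \<omega>) (\<lambda>\<omega>. Y \<omega> + c * Y' \<omega>)"
proof -
  interpret finite_measure M by (rule M)
  have [measurable]: "\<And>n. X n \<in> borel_measurable M" "\<And>n. X' n \<in> borel_measurable M"
    "Y \<in> borel_measurable M" "Y' \<in> borel_measurable M"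
    using X X' by (auto simp: conv_in_prob_def)
  have lim: "(\<lambda>n. measure M {\<omega>\<in>space M. \<bar>Z n \<omega> - W \<omega>\<bar> > e}) \<longlonglongrightarrow> 0"
    if "conv_in_prob M Z W" "e > 0" for Z W e
    using that by (simp add: conv_in_prob_def)
  have "(\<lambda>n. measure M {\<omega>\<in>space M. \<bar>(X n \<omega> + c * X' n \<omega>) - (Y \<omega> + c * Y' \<omega>)\<bar> > e}) \<longlonglongrightarrow> 0"
    if "e > 0" for e :: real
  proof -
    define d where "d = e / (2 * (\<bar>c\<bar> + 1))"
    have d: "d > 0" and cd: "\<bar>c\<bar> * d \<le> e / 2"
      using \<open>e > 0\<close> by (auto simp: d_def field_simps)
    have incl: "{\<omega>\<in>space M. \<bar>(X n \<omega> + c * X' n \<omega>) - (Y \<omega> + c * Y' \<omega>)\<bar> > e} \<subseteq>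
        {\<omega>\<in>space M. \<bar>X n \<omega> - Y \<omega>\<bar> > e / 2} \<union> {\<omega>\<in>space M. \<bar>X' n \<omega> - Y' \<omega>\<bar> > d}" for n
    proof (rule ccontr)
      assume "\<not> ?thesis"
      then obtain \<omega> where
        1: "\<bar>(X n \<omega> + c * X' n \<omega>) - (Y \<omega> + c * Y' \<omega>)\<bar> > e"
        and 2: "\<bar>X n \<omega> - Y \<omega>\<bar> \<le> e / 2" and 3: "\<bar>X' n \<omega> - Y' \<omega>\<bar> \<le> d"
        by force
      have "\<bar>c * (X' n \<omega> - Y' \<omega>)\<bar> \<le> \<bar>c\<bar> * d"
        using 3 by (simp add: abs_mult mult_left_mono)
      with cd have "\<bar>c * (X' n \<omega> - Y' \<omega>)\<bar> \<le> e / 2" by linarith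
      with 1 2 show False unfolding right_diff_distrib by linarith
    qed
    have bound: "measure M {\<omega>\<in>space M. \<bar>(X n \<omega> + c * X' n \<omega>) - (Y \<omega> + c * Y' \<omega>)\<bar> > e} \<le>
        measure M {\<omega>\<in>space M. \<bar>X n \<omega> - Y \<omega>\<bar> > e / 2} + measure M {\<omega>\<in>space M. \<bar>X' n \<omega> - Y' \<omega>\<bar> > d}"
      for n
      by (rule order_trans[OF finite_measure_mono[OF incl] measure_Un_le]) measurable
    have "(\<lambda>n. measure M {\<omega>\<in>space M. \<bar>X n \<omega> - Y \<omega>\<bar> > e / 2}
        + measure M {\<omega>\<in>space M. \<bar>X' n \<omega> - Y' \<omega>\<bar> > d}) \<longlonglongrightarrow> 0 + 0"
      by (intro tendsto_add lim[OF X] lim[OF X'] d half_gt_zero \<open>e > 0\<close>)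
    then have "(\<lambda>n. measure M {\<omega>\<in>space M. \<bar>X n \<omega> - Y \<omega>\<bar> > e / 2}
        + measure M {\<omega>\<in>space M. \<bar>X' n \<omega> - Y' \<omega>\<bar> > d}) \<longlonglongrightarrow> 0"
      by simp
    then show ?thesis
    proof (rule tendsto_sandwich[OF _ _ tendsto_const, rotated -1])
      show "\<forall>\<^sub>F n in sequentially. 0 \<le>
          measure M {\<omega>\<in>space M. \<bar>(X n \<omega> + c * X' n \<omega>) - (Y \<omega> + c * Y' \<omega>)\<bar> > e}"
        by simp
    qed (rule always_eventually, rule allI, rule bound)
  qed
  then show ?thesis by (auto simp: conv_in_prob_def)
qed

lemma has_strat_integral_lincomb:
  assumes "finite_measure M" "has_strat_integral M Y X t J" "has_strat_integral M Y' X t J'"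
  shows "has_strat_integral M (\<lambda>s \<omega>. Y s \<omega> + c * Y' s \<omega>) X t (\<lambda>\<omega>. J \<omega> + c * J' \<omega>)"
proof -
  have "strat_sum (\<lambda>s \<omega>. Y s \<omega> + c * Y' s \<omega>) X m p
      = (\<lambda>\<omega>. strat_sum Y X m p \<omega> + c * strat_sum Y' X m p \<omega>)" for m p
    by (auto simp: strat_sum_def fun_eq_iff sum_distrib_left sum.distrib[symmetric] field_simps
        intro!: sum.cong)
  then show ?thesis
    using assms conv_in_prob_lincomb[OF assms(1)] unfolding has_strat_integral_def by simp
qed

lemma has_noise_integral_lincomb:
  assumes "finite_measure M" "has_noise_integral M \<beta> y t S" "has_noise_integral M \<beta> y' t S'"
  shows "has_noise_integral M \<beta> (\<lambda>n s \<omega>. y n s \<omega> + c * y' n s \<omega>) t (\<lambda>\<omega>. S \<omega> + c * S' \<omega>)"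
proof -
  obtain J J' where J: "\<And>n. has_strat_integral M (y n) (\<beta> n) t (J n)"
      "conv_in_prob M (\<lambda>N \<omega>. \<Sum>n<N. J n \<omega>) S"
    and J': "\<And>n. has_strat_integral M (y' n) (\<beta> n) t (J' n)"
      "conv_in_prob M (\<lambda>N \<omega>. \<Sum>n<N. J' n \<omega>) S'"
    using assms by (auto simp: has_noise_integral_def)
  have "conv_in_prob M (\<lambda>N \<omega>. \<Sum>n<N. J n \<omega> + c * J' n \<omega>) (\<lambda>\<omega>. S \<omega> + c * S' \<omega>)"
    using conv_in_prob_lincomb[OF assms(1) J(2) J'(2), of c]
    by (simp add: sum.distrib sum_distrib_left)
  then show ?thesis
    using has_strat_integral_lincomb[OF assms(1) J(1) J'(1), of _ c]
    unfolding has_noise_integral_def by (intro exI[of _ "\<lambda>n \<omega>. J n \<omega> + c * J' n \<omega>"]) auto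
qed

lemma has_strat_differential_add:
  assumes M: "finite_measure M"
    and X: "has_strat_differential M \<beta> I X r y" and X': "has_strat_differential M \<beta> I X' r' y'"
  shows "has_strat_differential M \<beta> I (\<lambda>t \<omega>. X t \<omega> + X' t \<omega>) (\<lambda>t \<omega>. r t \<omega> + r' t \<omega>)
    (\<lambda>n t \<omega>. y n t \<omega> + y' n t \<omega>)"
  unfolding has_strat_differential_def
proof
  fix t assume "t \<in> I"
  obtain S where S: "has_noise_integral M \<beta> y t S" "AE \<omega> in M.
           set_integrable lborel {0..t} (\<lambda>s. r s \<omega>) \<and>
           X t \<omega> - X 0 \<omega> = (LINT s:{0..t}|lborel. r s \<omega>) + S \<omega>"
    using bspec[OF X[unfolded has_strat_differential_def] \<open>t \<in> I\<close>] by (elim exE conjE)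
  obtain S' where S': "has_noise_integral M \<beta> y' t S'" "AE \<omega> in M.
           set_integrable lborel {0..t} (\<lambda>s. r' s \<omega>) \<and>
           X' t \<omega> - X' 0 \<omega> = (LINT s:{0..t}|lborel. r' s \<omega>) + S' \<omega>"
    using bspec[OF X'[unfolded has_strat_differential_def] \<open>t \<in> I\<close>] by (elim exE conjE)
  have "AE \<omega> in M. set_integrable lborel {0..t} (\<lambda>s. r s \<omega> + r' s \<omega>) \<and>
      X t \<omega> + X' t \<omega> - (X 0 \<omega> + X' 0 \<omega>)
        = (LINT s:{0..t}|lborel. r s \<omega> + r' s \<omega>) + (S \<omega> + S' \<omega>)"
    using S(2) S'(2) by eventually_elim (auto simp: set_integral_add)
  then show "\<exists>S. has_noise_integral M \<beta> (\<lambda>n t \<omega>. y n t \<omega> + y' n t \<omega>) t S \<and>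
     (AE \<omega> in M. set_integrable lborel {0..t} (\<lambda>s. r s \<omega> + r' s \<omega>) \<and>
      X t \<omega> + X' t \<omega> - (X 0 \<omega> + X' 0 \<omega>) = (LINT s:{0..t}|lborel. r s \<omega> + r' s \<omega>) + S \<omega>)"
    using has_noise_integral_lincomb[OF M S(1) S'(1), of 1] by auto
qed

lemma has_strat_differential_of_equation:
  assumes M: "finite_measure M" and X: "strat_equation M \<beta> I X r y r' y'"
  shows "has_strat_differential M \<beta> I X (\<lambda>t \<omega>. r' t \<omega> - r t \<omega>) (\<lambda>n t \<omega>. y' n t \<omega> - y n t \<omega>)"
  unfolding has_strat_differential_def
proof
  fix t assume "t \<in> I"
  obtain S S' where S: "has_noise_integral M \<beta> y t S" "has_noise_integral M \<beta> y' t S'"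
    "AE \<omega> in M.
           set_integrable lborel {0..t} (\<lambda>s. r s \<omega>) \<and>
           set_integrable lborel {0..t} (\<lambda>s. r' s \<omega>) \<and>
           X t \<omega> - X 0 \<omega> + (LINT s:{0..t}|lborel. r s \<omega>) + S \<omega>
             = (LINT s:{0..t}|lborel. r' s \<omega>) + S' \<omega>"
    using bspec[OF X[unfolded strat_equation_def] \<open>t \<in> I\<close>] by (elim exE conjE)
  have "AE \<omega> in M. set_integrable lborel {0..t} (\<lambda>s. r' s \<omega> - r s \<omega>) \<and>
      X t \<omega> - X 0 \<omega> = (LINT s:{0..t}|lborel. r' s \<omega> - r s \<omega>) + (S' \<omega> - S \<omega>)"
    using S(3) by eventually_elim (auto simp: set_integral_diff)
  then show "\<exists>S. has_noise_integral M \<beta> (\<lambda>n t \<omega>. y' n t \<omega> - y n t \<omega>) t S \<and>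
     (AE \<omega> in M. set_integrable lborel {0..t} (\<lambda>s. r' s \<omega> - r s \<omega>) \<and>
      X t \<omega> - X 0 \<omega> = (LINT s:{0..t}|lborel. r' s \<omega> - r s \<omega>) + S \<omega>)"
    using has_noise_integral_lincomb[OF M S(2) S(1), of "-1"] by auto
qed

lemma has_strat_differential_const:
  "has_strat_differential M \<beta> I (\<lambda>t \<omega>. c) (\<lambda>t \<omega>. 0) (\<lambda>n t \<omega>. 0)"
proof -
  have 0: "conv_in_prob M (\<lambda>n \<omega>. 0) (\<lambda>\<omega>. 0)"
    by (auto simp: conv_in_prob_def)
  have "has_strat_integral M (\<lambda>t \<omega>. 0) (\<beta> n) t (\<lambda>\<omega>. 0)" for n t
    using 0 by (simp add: has_strat_integral_def strat_sum_def[abs_def])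
  then have "has_noise_integral M \<beta> (\<lambda>n t \<omega>. 0) t (\<lambda>\<omega>. 0)" for t
    unfolding has_noise_integral_def using 0 by (intro exI[of _ "\<lambda>n \<omega>. 0"]) auto
  then show ?thesis
    unfolding has_strat_differential_def
    by (intro ballI exI[of _ "\<lambda>\<omega>. 0"]) (auto simp: set_integrable_def set_lebesgue_integral_def)
qed


section \<open>Processes with vanishing differential\<close>

lemma conv_in_prob_zero_limit:
  assumes M: "finite_measure M" and "conv_in_prob M X Y"
    and X: "\<And>n. AE \<omega> in M. X n \<omega> = 0"
  shows "AE \<omega> in M. Y \<omega> = 0"
proof -
  interpret finite_measure M by (rule M)
  have [measurable]: "\<And>n. X n \<in> borel_measurable M" "Y \<in> borel_measurable M"
    and lim: "\<And>e. e > 0 \<Longrightarrow> (\<lambda>n. measure M {\<omega>\<in>space M. \<bar>X n \<omega> - Y \<omega>\<bar> > e}) \<longlonglongrightarrow> 0"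
    using assms(2) by (auto simp: conv_in_prob_def)
  have "AE \<omega> in M. \<not> \<bar>Y \<omega>\<bar> > 1 / real (Suc k)" for k
  proof -
    have "measure M {\<omega>\<in>space M. \<bar>X n \<omega> - Y \<omega>\<bar> > 1 / real (Suc k)}
        = measure M {\<omega>\<in>space M. \<bar>Y \<omega>\<bar> > 1 / real (Suc k)}" for n
      using X[of n] by (intro measure_eq_AE) auto
    with lim[of "1 / real (Suc k)"]
    have "measure M {\<omega>\<in>space M. \<bar>Y \<omega>\<bar> > 1 / real (Suc k)} = 0"
      by (simp add: LIMSEQ_const_iff)
    then show ?thesis
      by (subst AE_iff_measurable[OF _ refl]) (simp_all add: emeasure_eq_measure)
  qed
  then have "AE \<omega> in M. \<forall>k. \<not> \<bar>Y \<omega>\<bar> > 1 / real (Suc k)"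
    by (simp add: AE_all_countable)
  then show ?thesis
  proof eventually_elim
    case (elim \<omega>)
    then show ?case
      using reals_Archimedean[of "\<bar>Y \<omega>\<bar>"] by (force simp: inverse_eq_divide)
  qed
qed

lemma is_partition_bounds:
  assumes "is_partition t m p" "i \<le> m"
  shows "0 \<le> p i" "p i \<le> t"
proof -
  have step: "p k \<le> p (Suc k)" if "k < m" for k
    using assms(1) that by (simp add: is_partition_def)
  have "p 0 \<le> p i"
    using assms(2) by (induction i) (auto dest: step intro: order_trans[OF _ step])
  moreover have "p i \<le> p m"
    using assms(2) by (induction i rule: inc_induct) (auto intro: order_trans[OF step])
  ultimately show "0 \<le> p i" "p i \<le> t" using assms(1) by (auto simp: is_partition_def)
qed

lemma has_strat_integral_zero:
  assumes M: "finite_measure M" and "t \<ge> 0"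
    and Y: "\<And>s \<omega>. 0 \<le> s \<Longrightarrow> s \<le> t \<Longrightarrow> \<omega> \<in> space M \<Longrightarrow> Y s \<omega> = 0"
    and "has_strat_integral M Y X t J"
  shows "AE \<omega> in M. J \<omega> = 0"
proof -
  \<comment> \<open>The integral is a limit along partitions, so one sequence with mesh tending to 0 is needed.\<close>
  define p where "p = (\<lambda>k i. real i / real (Suc k) * t)"
  have part: "is_partition t (Suc k) (p k)" for k
    using \<open>t \<ge> 0\<close> by (auto simp: is_partition_def p_def intro!: mult_right_mono divide_right_mono)
  have step: "p k (Suc i) - p k i = t / real (Suc k)" for k i
  proof -
    have "p k (Suc i) - p k i = (real (Suc i) - real i) / real (Suc k) * t"
      by (simp only: p_def left_diff_distrib diff_divide_distrib)
    then show ?thesis by simp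
  qed
  have "(\<lambda>k. t / real (Suc k)) \<longlonglongrightarrow> 0"
    by (rule LIMSEQ_Suc[OF lim_const_over_n])
  then have "\<forall>\<delta>>0. \<forall>\<^sub>F k in sequentially. \<forall>i<Suc k. p k (Suc i) - p k i < \<delta>"
    unfolding step by (auto intro: eventually_mono dest: order_tendstoD(2))
  with part assms(4) have "conv_in_prob M (\<lambda>k. strat_sum Y X (Suc k) (p k)) J"
    unfolding has_strat_integral_def by blast
  then show ?thesis
  proof (rule conv_in_prob_zero_limit[OF M])
    fix k
    have "strat_sum Y X (Suc k) (p k) \<omega> = 0" if "\<omega> \<in> space M" for \<omega>
      unfolding strat_sum_def
      using that Y[OF is_partition_bounds[OF part]] by (intro sum.neutral) auto
    then show "AE \<omega> in M. strat_sum Y X (Suc k) (p k) \<omega> = 0" by auto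
  qed
qed

lemma has_strat_differential_zero:
  assumes M: "finite_measure M"
    and X: "has_strat_differential M \<beta> I X r y" and t: "t \<in> I" "t \<ge> 0" "{0..t} \<subseteq> I"
    and r: "\<And>s \<omega>. s \<in> I \<Longrightarrow> \<omega> \<in> space M \<Longrightarrow> r s \<omega> = 0"
    and y: "\<And>n s \<omega>. s \<in> I \<Longrightarrow> \<omega> \<in> space M \<Longrightarrow> y n s \<omega> = 0"
  shows "AE \<omega> in M. X t \<omega> = X 0 \<omega>"
proof -
  obtain S where S: "has_noise_integral M \<beta> y t S"
    and eq: "AE \<omega> in M. X t \<omega> - X 0 \<omega> = (LINT s:{0..t}|lborel. r s \<omega>) + S \<omega>"
    using X t(1) unfolding has_strat_differential_def by fastforce
  obtain J where J: "\<And>n. has_strat_integral M (y n) (\<beta> n) t (J n)"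
    and S: "conv_in_prob M (\<lambda>N \<omega>. \<Sum>n<N. J n \<omega>) S"
    using S by (auto simp: has_noise_integral_def)
  have "AE \<omega> in M. J n \<omega> = 0" for n
    using t(3) y by (intro has_strat_integral_zero[OF M t(2) _ J]) auto
  then have "AE \<omega> in M. \<forall>n. J n \<omega> = 0"
    by (simp add: AE_all_countable)
  then have "AE \<omega> in M. (\<Sum>n<N. J n \<omega>) = 0" for N
    by eventually_elim simp
  then have "AE \<omega> in M. S \<omega> = 0"
    by (rule conv_in_prob_zero_limit[OF M S])
  with eq AE_space show ?thesis
  proof eventually_elim
    case (elim \<omega>)
    have "(LINT s:{0..t}|lborel. r s \<omega>) = (LINT s:{0..t}|lborel. 0)"
      using t(3) r elim by (intro set_lebesgue_integral_cong) auto
    with elim show ?case by (simp add: set_lebesgue_integral_def)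
  qed
qed

text \<open>The exceptional set may be chosen independently of the time: equality at the times of a
  countable dense subset extends to all times by continuity.\<close>

lemma AE_constant_on_interval:
  fixes X :: "real \<Rightarrow> 'w \<Rightarrow> real"
  assumes "\<And>t. t \<in> I \<Longrightarrow> AE \<omega> in M. X t \<omega> = X 0 \<omega>"
    and "\<And>\<omega>. \<omega> \<in> space M \<Longrightarrow> continuous_on I (\<lambda>t. X t \<omega>)"
  shows "AE \<omega> in M. \<forall>t\<in>I. X t \<omega> = X 0 \<omega>"
proof -
  obtain T where T: "countable T" "T \<subseteq> I" "I \<subseteq> closure T"
    using separable by metis
  have "AE \<omega> in M. \<forall>t\<in>T. X t \<omega> = X 0 \<omega>"
    using T assms(1) by (subst AE_ball_countable) auto
  with AE_space show ?thesis
  proof eventually_elim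
    case (elim \<omega>)
    have "closedin (top_of_set I) {t\<in>I. X t \<omega> = X 0 \<omega>}"
      using continuous_closedin_preimage_constant[OF assms(2)[OF elim(1)], of "X 0 \<omega>"] by simp
    then obtain C where C: "closed C" "{t\<in>I. X t \<omega> = X 0 \<omega>} = I \<inter> C"
      by (auto simp: closedin_closed)
    have "T \<subseteq> C" using C elim T by blast
    then have "closure T \<subseteq> C" using C by (simp add: closure_minimal)
    with C T show ?case by blast
  qed
qed


section \<open>Calculus of periodic fields\<close>

text \<open>Periodic functions with continuous first partial derivatives. One derivative suffices to
  integrate a divergence, and closure under products is then immediate.\<close>

definition C1_periodic :: "real^'d::finite \<Rightarrow> real^'d \<Rightarrow> (real^'d \<Rightarrow> real) \<Rightarrow> bool" where
  "C1_periodic a b f \<longleftrightarrow>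
     (\<forall>x. f differentiable (at x)) \<and> (\<forall>i. continuous_on UNIV (pd i f)) \<and> periodic a b f"

lemma pd_eqI: "(f has_derivative f') (at x) \<Longrightarrow> pd i f x = f' (axis i 1)"
  unfolding pd_def by (simp add: frechet_derivative_at[symmetric])

lemma pd_const [simp]: "pd i (\<lambda>x. c) x = 0"
  by (rule pd_eqI[where f' = "\<lambda>_. 0"]) simp

lemma pd_add:
  assumes "f differentiable (at x)" "g differentiable (at x)"
  shows "pd i (\<lambda>x. f x + g x) x = pd i f x + pd i g x"
  using pd_eqI[OF has_derivative_add[OF assms[unfolded frechet_derivative_works]]]
  by (simp add: pd_def)

lemma pd_mult:
  assumes "f differentiable (at x)" "g differentiable (at x)"
  shows "pd i (\<lambda>x. f x * g x) x = f x * pd i g x + pd i f x * g x"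
  using pd_eqI[OF has_derivative_mult[OF assms[unfolded frechet_derivative_works]]]
  by (simp add: pd_def)

lemma C1_periodicD:
  assumes "C1_periodic a b f"
  shows "f differentiable (at x)" "continuous_on UNIV f" "continuous_on UNIV (pd i f)"
    "f (x + axis i (b $ i - a $ i)) = f x"
  using assms differentiable_imp_continuous_on[of f UNIV]
  by (auto simp: C1_periodic_def periodic_def differentiable_on_def)

lemma C1_periodic_const: "C1_periodic a b (\<lambda>x. c)"
proof -
  have "pd i (\<lambda>x. c) = (\<lambda>x. 0)" for i :: 'a by (simp add: fun_eq_iff)
  then show ?thesis by (simp add: C1_periodic_def periodic_def)
qed

lemma C1_periodic_add:
  assumes "C1_periodic a b f" "C1_periodic a b g"
  shows "C1_periodic a b (\<lambda>x. f x + g x)"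
proof -
  note D = C1_periodicD[OF assms(1)] C1_periodicD[OF assms(2)]
  have "pd i (\<lambda>x. f x + g x) = (\<lambda>x. pd i f x + pd i g x)" for i
    using D by (simp add: fun_eq_iff pd_add)
  then show ?thesis
    using D by (auto simp: C1_periodic_def periodic_def intro!: continuous_intros)
qed

lemma C1_periodic_mult:
  assumes "C1_periodic a b f" "C1_periodic a b g"
  shows "C1_periodic a b (\<lambda>x. f x * g x)"
proof -
  note D = C1_periodicD[OF assms(1)] C1_periodicD[OF assms(2)]
  have "pd i (\<lambda>x. f x * g x) = (\<lambda>x. f x * pd i g x + pd i f x * g x)" for i
    using D by (simp add: fun_eq_iff pd_mult)
  then show ?thesis
    using D by (auto simp: C1_periodic_def periodic_def intro!: continuous_intros)
qed

lemma C1_periodic_sum: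
  "(\<And>j. j \<in> A \<Longrightarrow> C1_periodic a b (f j)) \<Longrightarrow> C1_periodic a b (\<lambda>x. \<Sum>j\<in>A. f j x)"
  by (induction A rule: infinite_finite_induct)
    (auto intro: C1_periodic_const C1_periodic_add)

lemma pd_sum:
  "(\<And>j. j \<in> A \<Longrightarrow> f j differentiable (at x)) \<Longrightarrow>
    pd i (\<lambda>x. \<Sum>j\<in>A. f j x) x = (\<Sum>j\<in>A. pd i (f j) x)"
  by (induction A rule: infinite_finite_induct) (auto simp: pd_add)

lemma smooth_periodic_imp_C1_periodic:
  assumes "smooth_periodic a b f"
  shows "C1_periodic a b f"
proof -
  have *: "iter_pd is f differentiable (at x)" for "is" x
    using assms by (auto simp: smooth_periodic_def smooth_def)
  have "continuous_on UNIV (pd i f)" for i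
    using *[of "[i]"] by (auto intro!: differentiable_imp_continuous_on simp: differentiable_on_def)
  then show ?thesis
    using *[of "[]"] assms by (auto simp: C1_periodic_def smooth_periodic_def)
qed

text \<open>Translating the cell along an axis by at most a period moves a slab across it, and that
  slab is a period translate of the one left behind.\<close>

lemma integral_periodic_translate:
  fixes f :: "real^'d::finite \<Rightarrow> real"
  assumes f: "continuous_on UNIV f" and per: "\<And>x. f (x + axis i (b $ i - a $ i)) = f x"
    and s: "0 \<le> s" "s \<le> b $ i - a $ i"
  shows "integral (cbox a b) (\<lambda>x. f (x + axis i s)) = integral (cbox a b) f"
proof -
  have int: "f integrable_on cbox c d" for c d
    using f by (auto intro: integrable_continuous continuous_on_subset)
  have ax: "x \<bullet> axis i (1::real) = x $ i" for x :: "real^'d"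
    by (simp add: inner_axis)
  have bas: "axis i (1::real) \<in> Basis" by (simp add: axis_in_Basis_iff)
  have shift: "integral (cbox c d) (\<lambda>x. f (x + v)) = integral (cbox (c + v) (d + v)) f" for c d v
  proof -
    have "((\<lambda>x. f (x + v)) has_integral integral (cbox (c + v) (d + v)) f) (cbox c d)"
      using has_integral_affinity'[OF integrable_integral[OF int],
          where m = 1 and c = v and a = "c + v" and b = "d + v"]
      by simp
    then show ?thesis by (rule integral_unique)
  qed
  have split: "integral (cbox c d) f = integral (cbox c d \<inter> {x. x $ i \<le> r}) f
      + integral (cbox c d \<inter> {x. x $ i \<ge> r}) f" for c d r
    using integral_split[OF int bas, of c d r] by (simp add: ax)
  have mem: "x \<in> cbox c d \<longleftrightarrow> (c $ i \<le> x $ i \<and> x $ i \<le> d $ i) \<and>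
      (\<forall>j. j \<noteq> i \<longrightarrow> c $ j \<le> x $ j \<and> x $ j \<le> d $ j)" for x c d :: "real^'d"
    unfolding mem_box_cart by metis
  define L where "L = b $ i - a $ i"
  define v where "v = axis i s"
  \<comment> \<open>The hyperplane at \<open>a\<^sub>i + s\<close> cuts the cell into \<open>cbox a B\<close> and \<open>cbox A b\<close>.\<close>
  define A where "A = (\<chi> j. if j = i then a $ i + s else a $ j)"
  define B where "B = (\<chi> j. if j = i then a $ i + s else b $ j)"
  have v: "v $ j = (if j = i then s else 0)" for j by (simp add: v_def axis_def)
  have w: "axis i r $ j = (if j = i then r else 0)" for r :: real and j by (simp add: axis_def)
  have "cbox (a + v) (b + v) \<inter> {x. x $ i \<le> b $ i} = cbox A b"
    using s by (auto simp: mem v A_def)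
  moreover have "cbox (a + v) (b + v) \<inter> {x. x $ i \<ge> b $ i} = cbox (a + axis i L) (B + axis i L)"
    using s by (auto simp: mem v w B_def L_def)
  ultimately have "integral (cbox (a + v) (b + v)) f
      = integral (cbox A b) f + integral (cbox (a + axis i L) (B + axis i L)) f"
    using split[of "a + v" "b + v" "b $ i"] by simp
  also have "integral (cbox (a + axis i L) (B + axis i L)) f = integral (cbox a B) f"
    using shift[of a B "axis i L"] per by (simp add: L_def)
  also have "cbox A b = cbox a b \<inter> {x. x $ i \<ge> a $ i + s}"
    using s by (auto simp: mem A_def)
  also have "cbox a B = cbox a b \<inter> {x. x $ i \<le> a $ i + s}"
    using s by (auto simp: mem B_def)
  finally show ?thesis
    using split[of a b "a $ i + s"] shift[of a b v] by (simp add: v_def)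
qed

text \<open>The integral of the translates of \<open>f\<close> along an axis is constant, and differentiating under
  the integral sign at 0 gives the integral of the partial derivative.\<close>

lemma integral_pd_periodic:
  fixes f :: "real^'d::finite \<Rightarrow> real"
  assumes f: "C1_periodic a b f" and ab: "a $ i < b $ i"
  shows "integral (cbox a b) (pd i f) = 0"
proof -
  note D = C1_periodicD[OF f]
  define U where "U = {0..b $ i - a $ i}"
  have "((\<lambda>s. f (x + axis i s)) has_vector_derivative pd i f (x + axis i s)) (at s within U)" for x s
  proof -
    have "(\<lambda>s. x + axis i s) = (\<lambda>s. x + s *\<^sub>R axis i 1)"
      by (simp add: fun_eq_iff vec_eq_iff axis_def)
    then have "((\<lambda>s. x + axis i s) has_vector_derivative axis i 1) (at s within U)"
      by (simp only:) (auto intro!: derivative_eq_intros)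
    moreover have "(f has_derivative frechet_derivative f (at (x + axis i s)))
        (at (x + axis i s) within (\<lambda>s. x + axis i s) ` U)"
      using D(1) by (auto simp: frechet_derivative_works intro: has_derivative_at_withinI)
    ultimately show ?thesis
      using vector_derivative_diff_chain_within[of "\<lambda>s. x + axis i s" "axis i 1" s U f]
      by (simp add: o_def pd_def)
  qed
  moreover have "continuous_on (U \<times> cbox a b) (\<lambda>(s, x). pd i f (x + axis i s))"
  proof -
    have "(\<lambda>(s, x). pd i f (x + axis i s)) = (\<lambda>p. pd i f (snd p + fst p *\<^sub>R axis i 1))"
      by (auto simp: fun_eq_iff vec_eq_iff axis_def intro!: arg_cong[where f = "pd i f"])
    then show ?thesis
      by (simp only:) (intro continuous_on_compose2[OF D(3)] continuous_intros subset_UNIV)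
  qed
  moreover have "(\<lambda>x. f (x + axis i s)) integrable_on cbox a b" for s
    by (intro integrable_continuous continuous_on_compose2[OF D(2)] continuous_intros) auto
  ultimately have "((\<lambda>s. integral (cbox a b) (\<lambda>x. f (x + axis i s))) has_vector_derivative
      integral (cbox a b) (\<lambda>x. pd i f (x + axis i 0))) (at 0 within U)"
    using ab by (intro leibniz_rule_vector_derivative) (auto simp: U_def)
  moreover have "((\<lambda>s. integral (cbox a b) (\<lambda>x. f (x + axis i s))) has_vector_derivative 0)
      (at 0 within U)"
  proof (rule has_vector_derivative_transform[OF _ _ has_vector_derivative_const])
    show "0 \<in> U" using ab by (simp add: U_def)
    show "integral (cbox a b) (\<lambda>x. f (x + axis i s)) = integral (cbox a b) f" if "s \<in> U" for s
      using integral_periodic_translate[OF D(2) D(4)] that by (auto simp: U_def)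
  qed
  moreover have "at 0 within U \<noteq> bot"
    using ab by (simp add: U_def trivial_limit_within islimpt_Icc)
  ultimately have "integral (cbox a b) (\<lambda>x. pd i f (x + axis i 0)) = 0"
    by (rule vector_derivative_unique_within[rotated])
  moreover have "axis i 0 = (0 :: real^'d)" by (simp add: vec_eq_iff axis_def)
  ultimately show ?thesis by simp
qed

lemma set_integrable_cbox:
  fixes f :: "real^'d::finite \<Rightarrow> real"
  assumes "continuous_on (cbox a b) f"
  shows "set_integrable lborel (cbox a b) f"
  using borel_integrable_compact[OF compact_cbox assms]
  by (simp add: set_integrable_def)

lemma set_lebesgue_integral_cbox:
  fixes f :: "real^'d::finite \<Rightarrow> real"
  assumes "continuous_on (cbox a b) f"
  shows "(LINT x:cbox a b|lborel. f x) = integral (cbox a b) f"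
  by (rule set_borel_integral_eq_integral(2)[OF set_integrable_cbox[OF assms]])

lemma integral_divergence_periodic:
  fixes v :: "real^'d::finite \<Rightarrow> real^'d"
  assumes v: "\<And>i. C1_periodic a b (\<lambda>x. v x $ i)" and ab: "\<And>i. a $ i < b $ i"
  shows "(LINT x:cbox a b|lborel. divergence v x) = 0"
proof -
  have c: "continuous_on (cbox a b) (pd i (\<lambda>x. v x $ i))" for i
    using C1_periodicD(3)[OF v] continuous_on_subset by blast
  have "(LINT x:cbox a b|lborel. divergence v x)
      = integral (cbox a b) (\<lambda>x. \<Sum>i\<in>UNIV. pd i (\<lambda>x. v x $ i) x)"
    unfolding divergence_def
    using c by (intro set_lebesgue_integral_cbox continuous_intros)
  also have "\<dots> = (\<Sum>i\<in>UNIV. integral (cbox a b) (pd i (\<lambda>x. v x $ i)))"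
    using c by (intro integral_sum) (auto intro: integrable_continuous)
  finally show ?thesis
    using integral_pd_periodic[OF v ab] by simp
qed

section \<open>The energy density and its fluxes\<close>

text \<open>The energy per unit area as a function of the depth \<open>h\<close> and the velocity \<open>v\<close>. Squares are
  written as products, the form that the product rule for differentials yields.\<close>

definition energy_density :: "real \<Rightarrow> real \<Rightarrow> real^'d::finite \<Rightarrow> real" where
  "energy_density \<epsilon> h v = \<epsilon>\<^sup>2 / 2 * (h * (\<Sum>j\<in>UNIV. v $ j * v $ j)) + 1 / 2 * (h * h)"

text \<open>The first variation of the energy density when the elevation varies at rate \<open>r\<close>, hence the
  depth at rate \<open>\<epsilon> r\<close>, and the velocity components at rates \<open>s j\<close>.\<close>

definition energy_variation :: "real \<Rightarrow> real \<Rightarrow> real^'d::finite \<Rightarrow> real \<Rightarrow> ('d \<Rightarrow> real) \<Rightarrow> real" where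
  "energy_variation \<epsilon> h v r s =
     \<epsilon>\<^sup>2 / 2 * (h * (\<Sum>j\<in>UNIV. 2 * (v $ j * s j)) + (\<Sum>j\<in>UNIV. v $ j * v $ j) * (\<epsilon> * r))
     + h * (\<epsilon> * r)"

lemma energy_variation_add:
  "energy_variation \<epsilon> h v (r + r') (\<lambda>j. s j + s' j)
     = energy_variation \<epsilon> h v r s + energy_variation \<epsilon> h v r' s'"
  by (simp add: energy_variation_def ring_distribs sum.distrib)

lemma energy_variation_scale:
  "energy_variation \<epsilon> h v (c * r) (\<lambda>j. c * s j) = c * energy_variation \<epsilon> h v r s"
  by (simp add: energy_variation_def ring_distribs sum_distrib_left ac_simps)

lemma energy_variation_sum:
  "finite A \<Longrightarrow> energy_variation \<epsilon> h v (\<Sum>i\<in>A. r i) (\<lambda>j. \<Sum>i\<in>A. s i j)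
     = (\<Sum>i\<in>A. energy_variation \<epsilon> h v (r i) (s i))"
proof (induction A rule: finite_induct)
  case empty
  show ?case by (simp add: energy_variation_def)
qed (simp add: energy_variation_add)

lemma pd_mult_left: "f differentiable (at x) \<Longrightarrow> pd i (\<lambda>x. c * f x) x = c * pd i f x"
  by (subst pd_mult) auto

lemma divergence_scaleR:
  assumes "f differentiable (at x)" "\<And>i. (\<lambda>y. V y $ i) differentiable (at x)"
  shows "divergence (\<lambda>y. f y *\<^sub>R V y) x = V x \<bullet> grad f x + f x * divergence V x"
  using assms
  by (simp add: divergence_def grad_def inner_vec_def pd_mult sum.distrib sum_distrib_left ac_simps)

lemma divergence_add:
  assumes "\<And>i. (\<lambda>y. V y $ i) differentiable (at x)" "\<And>i. (\<lambda>y. W y $ i) differentiable (at x)"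
  shows "divergence (\<lambda>y. V y + W y) x = divergence V x + divergence W x"
  using assms by (simp add: divergence_def pd_add sum.distrib)

context
  fixes \<epsilon> :: real and a b :: "real^'d::finite"
    and z :: "real^'d \<Rightarrow> real" and U :: "real^'d \<Rightarrow> real^'d"
  assumes z: "C1_periodic a b z" and U: "\<And>j. C1_periodic a b (\<lambda>x. U x $ j)"
begin

lemma C1_periodic_energy_density:
  "C1_periodic a b (\<lambda>x. energy_density \<epsilon> (1 + \<epsilon> * z x) (U x))"
  unfolding energy_density_def
  by (intro C1_periodic_add C1_periodic_mult C1_periodic_sum C1_periodic_const z U)

lemma pd_energy_density:
  "pd i (\<lambda>x. energy_density \<epsilon> (1 + \<epsilon> * z x) (U x)) x
     = energy_variation \<epsilon> (1 + \<epsilon> * z x) (U x) (pd i z x) (\<lambda>j. pd i (\<lambda>y. U y $ j) x)"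
proof -
  define h where "h = (\<lambda>x. 1 + \<epsilon> * z x)"
  define q where "q = (\<lambda>x. \<Sum>j\<in>UNIV. U x $ j * U x $ j)"
  have h: "h differentiable (at x)" and pd_h: "pd i h x = \<epsilon> * pd i z x"
    using C1_periodicD(1)[OF z] by (simp_all add: h_def pd_add pd_mult_left)
  have q: "q differentiable (at x)"
    using C1_periodicD(1)[OF U] by (simp add: q_def differentiable_sum)
  have pd_q: "pd i q x = (\<Sum>j\<in>UNIV. 2 * (U x $ j * pd i (\<lambda>y. U y $ j) x))"
    using C1_periodicD(1)[OF U] by (simp add: q_def pd_sum pd_mult mult.commute)
  have "pd i (\<lambda>x. \<epsilon>\<^sup>2 / 2 * (h x * q x) + 1 / 2 * (h x * h x)) x
      = \<epsilon>\<^sup>2 / 2 * (h x * pd i q x + pd i h x * q x) + 1 / 2 * (h x * pd i h x + pd i h x * h x)"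
    using h q by (simp only: pd_add pd_mult_left pd_mult differentiable_mult differentiable_const)
  then show ?thesis
    unfolding energy_density_def energy_variation_def pd_h pd_q
    by (simp add: h_def q_def ac_simps)
qed

text \<open>By linearity of the variation, transport of elevation and velocity along \<open>V\<close> transports the
  energy density.\<close>

lemma energy_variation_transport:
  "energy_variation \<epsilon> (1 + \<epsilon> * z x) (U x) (V \<bullet> grad z x) (\<lambda>j. V \<bullet> grad (\<lambda>y. U y $ j) x)
     = V \<bullet> grad (\<lambda>x. energy_density \<epsilon> (1 + \<epsilon> * z x) (U x)) x"
  by (simp add: inner_vec_def grad_def energy_variation_sum energy_variation_scale
      pd_energy_density)

text \<open>With \<open>c = sqrt \<Upsilon> \<epsilon>\<close> and \<open>V = \<phi>\<^sub>n\<close> the left-hand side is the noise coefficient of the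
  energy density.\<close>

lemma energy_noise_is_divergence:
  assumes V: "\<And>j. C1_periodic a b (\<lambda>x. V x $ j)" and div: "divergence V x = 0"
  shows "energy_variation \<epsilon> (1 + \<epsilon> * z x) (U x) (- (c * (V x \<bullet> grad z x)))
      (\<lambda>j. - (c * (V x \<bullet> grad (\<lambda>y. U y $ j) x)))
    = - c * divergence (\<lambda>x. energy_density \<epsilon> (1 + \<epsilon> * z x) (U x) *\<^sub>R V x) x"
  using energy_variation_scale[of \<epsilon> "1 + \<epsilon> * z x" "U x" "- c" "V x \<bullet> grad z x"
      "\<lambda>j. V x \<bullet> grad (\<lambda>y. U y $ j) x"]
    C1_periodicD(1)[OF C1_periodic_energy_density] C1_periodicD(1)[OF V]
  by (simp add: energy_variation_transport divergence_scaleR div)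

text \<open>The drift: transport contributes \<open>- \<epsilon> V \<bullet> \<nabla>e\<close>, and the variation of the remaining terms,
  mass divergence and pressure gradient, completes it to the divergence of the energy flux.\<close>

lemma energy_drift_is_divergence:
  assumes V: "\<And>j. C1_periodic a b (\<lambda>x. V x $ j)" and div: "divergence V x = divergence U x"
  defines "h \<equiv> \<lambda>x. 1 + \<epsilon> * z x"
  shows "energy_variation \<epsilon> (h x) (U x) (- (h x * divergence V x) - \<epsilon> * (V x \<bullet> grad z x))
      (\<lambda>j. - pd j z x - \<epsilon> * (V x \<bullet> grad (\<lambda>y. U y $ j) x))
    = - \<epsilon> * divergence (\<lambda>x. energy_density \<epsilon> (h x) (U x) *\<^sub>R V x + (h x * h x / 2) *\<^sub>R U x) x"
proof -
  define e where "e = (\<lambda>x. energy_density \<epsilon> (h x) (U x))"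
  have e: "C1_periodic a b e"
    using C1_periodic_energy_density by (simp add: e_def h_def)
  have p: "C1_periodic a b (\<lambda>x. 1 / 2 * (h x * h x))"
    unfolding h_def by (intro C1_periodic_mult C1_periodic_add C1_periodic_const z)
  note D = C1_periodicD(1)[OF z] C1_periodicD(1)[OF U] C1_periodicD(1)[OF V]
    C1_periodicD(1)[OF e] C1_periodicD(1)[OF p]
  have h: "h differentiable (at x)" and pd_h: "pd i h x = \<epsilon> * pd i z x" for i
    using D(1) by (simp_all add: h_def pd_add pd_mult_left)
  have "pd i (\<lambda>x. 1 / 2 * (h x * h x)) x = 1 / 2 * (h x * pd i h x + pd i h x * h x)" for i
    using h by (simp only: pd_mult_left pd_mult differentiable_mult)
  then have "pd i (\<lambda>x. 1 / 2 * (h x * h x)) x = \<epsilon> * h x * pd i z x" for i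
    by (simp add: pd_h)
  then have grad_p: "grad (\<lambda>x. 1 / 2 * (h x * h x)) x = (\<epsilon> * h x) *\<^sub>R grad z x"
    by (simp add: grad_def vec_eq_iff)
  have "divergence (\<lambda>x. e x *\<^sub>R V x + (1 / 2 * (h x * h x)) *\<^sub>R U x) x
      = V x \<bullet> grad e x + e x * divergence V x
        + \<epsilon> * h x * (U x \<bullet> grad z x) + 1 / 2 * (h x * h x) * divergence U x"
    using D C1_periodicD(1)[OF C1_periodic_mult[OF e V]]
      C1_periodicD(1)[OF C1_periodic_mult[OF p U]]
    by (subst divergence_add) (simp_all add: divergence_scaleR grad_p del: times_divide_eq_left)
  also have "V x \<bullet> grad e x = energy_variation \<epsilon> (h x) (U x) (V x \<bullet> grad z x)
      (\<lambda>j. V x \<bullet> grad (\<lambda>y. U y $ j) x)"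
    using energy_variation_transport[of x "V x"] by (simp add: e_def h_def)
  finally have rhs: "divergence (\<lambda>x. e x *\<^sub>R V x + (1 / 2 * (h x * h x)) *\<^sub>R U x) x
      = energy_variation \<epsilon> (h x) (U x) (V x \<bullet> grad z x) (\<lambda>j. V x \<bullet> grad (\<lambda>y. U y $ j) x)
        + e x * divergence V x
        + \<epsilon> * h x * (U x \<bullet> grad z x) + 1 / 2 * (h x * h x) * divergence U x" .
  have "energy_variation \<epsilon> (h x) (U x) (- (h x * divergence V x)) (\<lambda>j. - pd j z x)
      = - \<epsilon> * (e x * divergence V x + \<epsilon> * h x * (U x \<bullet> grad z x)
          + 1 / 2 * (h x * h x) * divergence U x)"
    by (simp add: energy_variation_def e_def energy_density_def inner_vec_def grad_def div
        sum_negf sum_distrib_left[symmetric] field_simps power2_eq_square)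
  with energy_variation_add[of \<epsilon> "h x" "U x" "- (h x * divergence V x)"
      "- \<epsilon> * (V x \<bullet> grad z x)" "\<lambda>j. - pd j z x" "\<lambda>j. - \<epsilon> * (V x \<bullet> grad (\<lambda>y. U y $ j) x)"]
    energy_variation_scale[of \<epsilon> "h x" "U x" "- \<epsilon>" "V x \<bullet> grad z x"
      "\<lambda>j. V x \<bullet> grad (\<lambda>y. U y $ j) x"] rhs
  show ?thesis by (simp add: e_def algebra_simps)
qed

end


section \<open>The stochastic differential of the energy\<close>

text \<open>A formal field differential that is generated by the unknowns, so that the calculus rules may
  be applied to it, and that holds as a Stratonovich differential at every position.\<close>

definition realised_fdiff ::
    "'w measure \<Rightarrow> (nat \<Rightarrow> 'w process) \<Rightarrow> real set \<Rightarrow> real \<Rightarrow> real \<Rightarrow> ('w, 'd::finite) vfield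
      \<Rightarrow> (nat \<Rightarrow> ('w, 'd) vfield) \<Rightarrow> ('w, 'd) field \<Rightarrow> ('w, 'd) vfield \<Rightarrow> ('w, 'd) fdiff \<Rightarrow> bool" where
  "realised_fdiff M \<beta> I \<epsilon> \<Upsilon> us \<phi> \<eta> u D \<longleftrightarrow>
     D \<in> generated_fdiffs \<epsilon> \<Upsilon> us \<phi> \<eta> u \<and> valid_fdiff M \<beta> I D"

context
  fixes M :: "'w measure" and \<beta> :: "nat \<Rightarrow> 'w process" and I :: "real set"
    and a b :: "real^'d::finite" and \<epsilon> \<Upsilon> :: real and us u :: "('w, 'd) vfield"
    and \<phi> :: "nat \<Rightarrow> ('w, 'd) vfield" and \<eta> :: "('w, 'd) field"
  assumes M: "finite_measure M"
    and calc: "strat_calculus_applies M \<beta> I a b (generated_fdiffs \<epsilon> \<Upsilon> us \<phi> \<eta> u)"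
    and solution: "LU_saint_venant M \<beta> I \<epsilon> \<Upsilon> us \<phi> \<eta> u"
begin

abbreviation (input) "realised \<equiv> realised_fdiff M \<beta> I \<epsilon> \<Upsilon> us \<phi> \<eta> u"

lemma realised_const: "realised ((\<lambda>t \<omega> x. c), (\<lambda>t \<omega> x. 0), (\<lambda>n t \<omega> x. 0))"
  by (auto simp: realised_fdiff_def valid_fdiff_def has_strat_differential_const
      intro: generated_fdiffs.const)

lemma realised_add:
  assumes "realised (X, r, y)" "realised (X', r', y')"
  shows "realised ((\<lambda>t \<omega> x. X t \<omega> x + X' t \<omega> x), (\<lambda>t \<omega> x. r t \<omega> x + r' t \<omega> x),
      (\<lambda>n t \<omega> x. y n t \<omega> x + y' n t \<omega> x))"
  using assms generated_fdiffs.add[of "(X, r, y)" \<epsilon> \<Upsilon> us \<phi> \<eta> u "(X', r', y')"]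
  by (auto simp: realised_fdiff_def valid_fdiff_def intro!: has_strat_differential_add[OF M])

lemma realised_mult:
  assumes "realised (X, r, y)" "realised (X', r', y')"
  shows "realised ((\<lambda>t \<omega> x. X t \<omega> x * X' t \<omega> x), (\<lambda>t \<omega> x. X t \<omega> x * r' t \<omega> x + X' t \<omega> x * r t \<omega> x),
      (\<lambda>n t \<omega> x. X t \<omega> x * y' n t \<omega> x + X' t \<omega> x * y n t \<omega> x))"
  using assms generated_fdiffs.mult[of "(X, r, y)" \<epsilon> \<Upsilon> us \<phi> \<eta> u "(X', r', y')"] calc
  unfolding realised_fdiff_def strat_calculus_applies_def mult_fdiff.simps[symmetric] by blast

lemma realised_scale:
  assumes "realised (X, r, y)"
  shows "realised ((\<lambda>t \<omega> x. c * X t \<omega> x), (\<lambda>t \<omega> x. c * r t \<omega> x), (\<lambda>n t \<omega> x. c * y n t \<omega> x))"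
  using realised_mult[OF realised_const[of c] assms] by simp

lemma realised_sum:
  assumes "finite A" "\<And>j. realised (X j, r j, y j)"
  shows "realised ((\<lambda>t \<omega> x. \<Sum>j\<in>A. X j t \<omega> x), (\<lambda>t \<omega> x. \<Sum>j\<in>A. r j t \<omega> x),
      (\<lambda>n t \<omega> x. \<Sum>j\<in>A. y j n t \<omega> x))"
  using assms(1)
proof (induction A rule: finite_induct)
  case empty
  show ?case using realised_const[of 0] by simp
next
  case (insert j A)
  then show ?case using realised_add[OF assms(2)[of j] insert.IH] by simp
qed

lemma realised_elevation:
  "realised (\<eta>, (\<lambda>t \<omega> x. mass_drift \<epsilon> \<Upsilon> us \<eta> u t \<omega> x - \<epsilon> * advect (ustar \<epsilon> \<Upsilon> us u) \<eta> t \<omega> x),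
     (\<lambda>n t \<omega> x. mass_noise \<epsilon> \<Upsilon> \<phi> \<eta> n t \<omega> x - sqrt \<Upsilon> * \<epsilon> * advect (\<phi> n) \<eta> t \<omega> x))"
  using generated_fdiffs.elevation[of \<epsilon> \<Upsilon> us u \<phi> \<eta>] solution
  by (auto simp: realised_fdiff_def transport_fdiff_def valid_fdiff_def LU_saint_venant_def
      stoch_transport_def intro!: has_strat_differential_of_equation[OF M])

lemma realised_velocity:
  "realised (vcomp i u, (\<lambda>t \<omega> x. - pd i (\<eta> t \<omega>) x - \<epsilon> * advect (ustar \<epsilon> \<Upsilon> us u) (vcomp i u) t \<omega> x),
     (\<lambda>n t \<omega> x. 0 - sqrt \<Upsilon> * \<epsilon> * advect (\<phi> n) (vcomp i u) t \<omega> x))"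
  using generated_fdiffs.velocity[of \<epsilon> \<Upsilon> us u \<phi> i \<eta>] solution
  unfolding realised_fdiff_def transport_fdiff_def valid_fdiff_def LU_saint_venant_def
      stoch_transport_def
  by (auto simp del: diff_0 intro!: has_strat_differential_of_equation[OF M])

lemma realised_energy_density:
  "realised ((\<lambda>t \<omega> x. energy_density \<epsilon> (depth \<epsilon> \<eta> t \<omega> x) (u t \<omega> x)),
     (\<lambda>t \<omega> x. energy_variation \<epsilon> (depth \<epsilon> \<eta> t \<omega> x) (u t \<omega> x)
        (mass_drift \<epsilon> \<Upsilon> us \<eta> u t \<omega> x - \<epsilon> * advect (ustar \<epsilon> \<Upsilon> us u) \<eta> t \<omega> x)
        (\<lambda>j. - pd j (\<eta> t \<omega>) x - \<epsilon> * advect (ustar \<epsilon> \<Upsilon> us u) (vcomp j u) t \<omega> x)),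
     (\<lambda>n t \<omega> x. energy_variation \<epsilon> (depth \<epsilon> \<eta> t \<omega> x) (u t \<omega> x)
        (mass_noise \<epsilon> \<Upsilon> \<phi> \<eta> n t \<omega> x - sqrt \<Upsilon> * \<epsilon> * advect (\<phi> n) \<eta> t \<omega> x)
        (\<lambda>j. 0 - sqrt \<Upsilon> * \<epsilon> * advect (\<phi> n) (vcomp j u) t \<omega> x)))"
proof -
  note h = realised_add[OF realised_const[of 1] realised_scale[OF realised_elevation, of \<epsilon>]]
  have square: "realised ((\<lambda>t \<omega> x. u t \<omega> x $ j * u t \<omega> x $ j),
     (\<lambda>t \<omega> x. 2 * (u t \<omega> x $ j *
        (- pd j (\<eta> t \<omega>) x - \<epsilon> * advect (ustar \<epsilon> \<Upsilon> us u) (vcomp j u) t \<omega> x))),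
     (\<lambda>n t \<omega> x. 2 * (u t \<omega> x $ j *
        (0 - sqrt \<Upsilon> * \<epsilon> * advect (\<phi> n) (vcomp j u) t \<omega> x))))" for j
    by (rule back_subst[where P = realised,
          OF realised_mult[OF realised_velocity[of j] realised_velocity[of j]]])
      (simp add: vcomp_def fun_eq_iff)
  have q: "realised ((\<lambda>t \<omega> x. \<Sum>j\<in>UNIV. u t \<omega> x $ j * u t \<omega> x $ j),
     (\<lambda>t \<omega> x. \<Sum>j\<in>UNIV. 2 * (u t \<omega> x $ j *
        (- pd j (\<eta> t \<omega>) x - \<epsilon> * advect (ustar \<epsilon> \<Upsilon> us u) (vcomp j u) t \<omega> x))),
     (\<lambda>n t \<omega> x. \<Sum>j\<in>UNIV. 2 * (u t \<omega> x $ j *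
        (0 - sqrt \<Upsilon> * \<epsilon> * advect (\<phi> n) (vcomp j u) t \<omega> x))))"
    by (intro realised_sum square finite)
  note e = realised_add[OF realised_scale[OF realised_mult[OF h q], of "\<epsilon>\<^sup>2 / 2"]
      realised_scale[OF realised_mult[OF h h], of "1 / 2"]]
  show ?thesis
    by (rule back_subst[where P = realised, OF e])
      (simp add: energy_density_def energy_variation_def depth_def vcomp_def fun_eq_iff)
qed

lemma energy_differential:
  "has_strat_differential M \<beta> I
     (\<lambda>t \<omega>. LINT x:cbox a b|lborel. energy_density \<epsilon> (depth \<epsilon> \<eta> t \<omega> x) (u t \<omega> x))
     (\<lambda>t \<omega>. LINT x:cbox a b|lborel. energy_variation \<epsilon> (depth \<epsilon> \<eta> t \<omega> x) (u t \<omega> x)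
        (mass_drift \<epsilon> \<Upsilon> us \<eta> u t \<omega> x - \<epsilon> * advect (ustar \<epsilon> \<Upsilon> us u) \<eta> t \<omega> x)
        (\<lambda>j. - pd j (\<eta> t \<omega>) x - \<epsilon> * advect (ustar \<epsilon> \<Upsilon> us u) (vcomp j u) t \<omega> x))
     (\<lambda>n t \<omega>. LINT x:cbox a b|lborel. energy_variation \<epsilon> (depth \<epsilon> \<eta> t \<omega> x) (u t \<omega> x)
        (mass_noise \<epsilon> \<Upsilon> \<phi> \<eta> n t \<omega> x - sqrt \<Upsilon> * \<epsilon> * advect (\<phi> n) \<eta> t \<omega> x)
        (\<lambda>j. 0 - sqrt \<Upsilon> * \<epsilon> * advect (\<phi> n) (vcomp j u) t \<omega> x))"
  using realised_energy_density calc
  unfolding realised_fdiff_def strat_calculus_applies_def valid_integrated_fdiff_def by fastforce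

end

lemma SW_energy_eq:
  assumes "continuous_on (cbox a b) (\<eta> t \<omega>)" "\<And>j. continuous_on (cbox a b) (vcomp j u t \<omega>)"
  shows "SW_energy a b \<epsilon> \<eta> u t \<omega>
    = (LINT x:cbox a b|lborel. energy_density \<epsilon> (depth \<epsilon> \<eta> t \<omega> x) (u t \<omega> x))"
proof -
  have q: "(norm v)\<^sup>2 = (\<Sum>j\<in>UNIV. v $ j * v $ j)" for v :: "real^'d"
    unfolding power2_norm_eq_inner inner_vec_def by simp
  have [continuous_intros]: "continuous_on (cbox a b) (\<lambda>x. u t \<omega> x $ j)" for j
    using assms(2)[of j] by (simp add: vcomp_def[abs_def])
  have "set_integrable lborel (cbox a b)
      (\<lambda>x. \<epsilon>\<^sup>2 / 2 * (depth \<epsilon> \<eta> t \<omega> x * (\<Sum>j\<in>UNIV. u t \<omega> x $ j * u t \<omega> x $ j)))"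
    "set_integrable lborel (cbox a b) (\<lambda>x. 1 / 2 * (depth \<epsilon> \<eta> t \<omega> x * depth \<epsilon> \<eta> t \<omega> x))"
    unfolding depth_def using assms(1) by (auto intro!: set_integrable_cbox continuous_intros)
  from set_integral_add(2)[OF this] show ?thesis
    by (simp only: SW_energy_def energy_density_def q power2_eq_square[of "depth _ _ _ _ _"]
        set_integral_mult_right)
qed

theorem mainTheorem3:
  fixes M :: "'w measure" and F :: "real \<Rightarrow> 'w measure" and \<beta> :: "nat \<Rightarrow> real \<Rightarrow> 'w \<Rightarrow> real"
    and I :: "real set"
    and a b :: "real ^ 'd::finite"
    and \<epsilon> \<Upsilon> :: real
    and us :: "real \<Rightarrow> 'w \<Rightarrow> real ^ 'd \<Rightarrow> real ^ 'd"
    and \<phi> :: "nat \<Rightarrow> real \<Rightarrow> 'w \<Rightarrow> real ^ 'd \<Rightarrow> real ^ 'd"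
    and \<eta> :: "real \<Rightarrow> 'w \<Rightarrow> real ^ 'd \<Rightarrow> real"
    and u :: "real \<Rightarrow> 'w \<Rightarrow> real ^ 'd \<Rightarrow> real ^ 'd"
  assumes dim: "CARD('d) \<in> {1, 2}"
    and cell: "\<And>i. a $ i < b $ i"
    and params: "\<epsilon> > 0" "\<Upsilon> > 0"
    and time: "is_interval I" "0 \<in> I" "I \<subseteq> {0..}"
    and stoch_basis: "filtered_prob_space M F"
    and brownian: "independent_brownian_motions M F \<beta>"
    and regular: "sufficiently_regular M F \<beta> I a b \<epsilon> \<Upsilon> us \<phi> \<eta> u"
    and depth_pos: "\<And>t \<omega> x. t \<in> I \<Longrightarrow> \<omega> \<in> space M \<Longrightarrow> depth \<epsilon> \<eta> t \<omega> x > 0"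
    and solution: "LU_saint_venant M \<beta> I \<epsilon> \<Upsilon> us \<phi> \<eta> u"
    and noise_boundary: "\<And>n t \<omega> x. t \<in> I \<Longrightarrow> \<omega> \<in> space M \<Longrightarrow> x \<in> frontier (cbox a b)
        \<Longrightarrow> \<phi> n t \<omega> x = 0"
    and noise_div_free: "\<And>n t \<omega> x. t \<in> I \<Longrightarrow> \<omega> \<in> space M \<Longrightarrow> divergence (\<phi> n t \<omega>) x = 0"
    and drift_div_free: "\<And>t \<omega> x. t \<in> I \<Longrightarrow> \<omega> \<in> space M \<Longrightarrow> divergence (us t \<omega>) x = 0"
  shows "AE \<omega> in M. \<forall>t\<in>I. SW_energy a b \<epsilon> \<eta> u t \<omega> = SW_energy a b \<epsilon> \<eta> u 0 \<omega>"
proof -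
  interpret prob_space M
    using stoch_basis by (simp add: filtered_prob_space_def)
  have M: "finite_measure M" by (rule finite_measure_axioms)
  let ?v = "ustar \<epsilon> \<Upsilon> us u"
  define E where "E = (\<lambda>t \<omega>. LINT x:cbox a b|lborel.
    energy_density \<epsilon> (depth \<epsilon> \<eta> t \<omega> x) (u t \<omega> x))"
  have calc: "strat_calculus_applies M \<beta> I a b (generated_fdiffs \<epsilon> \<Upsilon> us \<phi> \<eta> u)"
    and \<eta>: "smooth_semimartingale_field M F I a b \<eta>"
    and u: "\<And>i. smooth_semimartingale_field M F I a b (vcomp i u)"
    using regular by (auto simp: sufficiently_regular_def)
  have C_\<eta>: "C1_periodic a b (\<eta> t \<omega>)"
    and C_u: "C1_periodic a b (\<lambda>x. u t \<omega> x $ i)"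
    and C_us: "C1_periodic a b (\<lambda>x. us t \<omega> x $ i)"
    and C_\<phi>: "C1_periodic a b (\<lambda>x. \<phi> n t \<omega> x $ i)"
    if "t \<in> I" "\<omega> \<in> space M" for t \<omega> i n
    using regular that
    by (auto intro!: smooth_periodic_imp_C1_periodic
        simp: sufficiently_regular_def smooth_semimartingale_field_def vcomp_def[abs_def])
  have C_v: "C1_periodic a b (\<lambda>x. ?v t \<omega> x $ i)" if "t \<in> I" "\<omega> \<in> space M" for t \<omega> i
    using C1_periodic_add[OF C_u[OF that] C1_periodic_mult[OF C1_periodic_const[where c = "- (\<Upsilon> * \<epsilon> / 2)"]
        C_us[OF that]]]
    by (simp add: ustar_def)
  have div_v: "divergence (?v t \<omega>) x = divergence (u t \<omega>) x"
    if "t \<in> I" "\<omega> \<in> space M" for t \<omega> x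
  proof -
    note D = C1_periodicD(1)[OF C_u[OF that]] C1_periodicD(1)[OF C_us[OF that]]
    have "divergence (?v t \<omega>) x
        = divergence (\<lambda>x. u t \<omega> x + (- (\<Upsilon> * \<epsilon> / 2)) *\<^sub>R us t \<omega> x) x"
      by (simp add: ustar_def[abs_def])
    also have "\<dots> = divergence (u t \<omega>) x
        + divergence (\<lambda>x. (- (\<Upsilon> * \<epsilon> / 2)) *\<^sub>R us t \<omega> x) x"
      using D by (intro divergence_add) auto
    also have "divergence (\<lambda>x. (- (\<Upsilon> * \<epsilon> / 2)) *\<^sub>R us t \<omega> x) x = 0"
      using D drift_div_free[OF that]
      by (subst divergence_scaleR) (auto simp: grad_def inner_vec_def)
    finally show ?thesis by simp
  qed
  have drift: "(LINT x:cbox a b|lborel. energy_variation \<epsilon> (depth \<epsilon> \<eta> t \<omega> x) (u t \<omega> x)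
        (mass_drift \<epsilon> \<Upsilon> us \<eta> u t \<omega> x - \<epsilon> * advect ?v \<eta> t \<omega> x)
        (\<lambda>j. - pd j (\<eta> t \<omega>) x - \<epsilon> * advect ?v (vcomp j u) t \<omega> x)) = 0"
    if t: "t \<in> I" "\<omega> \<in> space M" for t \<omega>
  proof -
    let ?h = "\<lambda>x. 1 + \<epsilon> * \<eta> t \<omega> x"
    let ?w = "\<lambda>x. energy_density \<epsilon> (?h x) (u t \<omega> x) *\<^sub>R ?v t \<omega> x + (?h x * ?h x / 2) *\<^sub>R u t \<omega> x"
    have "C1_periodic a b (\<lambda>x. energy_density \<epsilon> (?h x) (u t \<omega> x) * ?v t \<omega> x $ i
        + 1 / 2 * (?h x * ?h x) * u t \<omega> x $ i)" for i
      by (intro C1_periodic_add C1_periodic_mult C1_periodic_const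
          C1_periodic_energy_density C_\<eta> C_u C_v t)
    then have "C1_periodic a b (\<lambda>x. ?w x $ i)" for i by simp
    then have "(LINT x:cbox a b|lborel. divergence ?w x) = 0"
      using cell by (rule integral_divergence_periodic)
    then have "(LINT x:cbox a b|lborel. - \<epsilon> * divergence ?w x) = 0"
      by (simp only: set_integral_mult_right)
    with energy_drift_is_divergence[where V = "?v t \<omega>", OF C_\<eta>[OF t] C_u[OF t] C_v[OF t] div_v[OF t]]
    show ?thesis
      by (simp add: depth_def mass_drift_def advect_def vcomp_def[abs_def])
  qed
  have noise: "(LINT x:cbox a b|lborel. energy_variation \<epsilon> (depth \<epsilon> \<eta> t \<omega> x) (u t \<omega> x)
        (mass_noise \<epsilon> \<Upsilon> \<phi> \<eta> n t \<omega> x - sqrt \<Upsilon> * \<epsilon> * advect (\<phi> n) \<eta> t \<omega> x)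
        (\<lambda>j. 0 - sqrt \<Upsilon> * \<epsilon> * advect (\<phi> n) (vcomp j u) t \<omega> x)) = 0"
    if t: "t \<in> I" "\<omega> \<in> space M" for n t \<omega>
  proof -
    let ?w = "\<lambda>x. energy_density \<epsilon> (1 + \<epsilon> * \<eta> t \<omega> x) (u t \<omega> x) *\<^sub>R \<phi> n t \<omega> x"
    have "C1_periodic a b (\<lambda>x. energy_density \<epsilon> (1 + \<epsilon> * \<eta> t \<omega> x) (u t \<omega> x) * \<phi> n t \<omega> x $ i)" for i
      by (intro C1_periodic_mult C1_periodic_energy_density C_\<eta> C_u C_\<phi> t)
    then have "C1_periodic a b (\<lambda>x. ?w x $ i)" for i by simp
    then have "(LINT x:cbox a b|lborel. divergence ?w x) = 0"
      using cell by (rule integral_divergence_periodic)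
    then have "(LINT x:cbox a b|lborel. - (sqrt \<Upsilon> * \<epsilon>) * divergence ?w x) = 0"
      by (simp only: set_integral_mult_right)
    with energy_noise_is_divergence[where V = "\<phi> n t \<omega>" and c = "sqrt \<Upsilon> * \<epsilon>", OF C_\<eta>[OF t] C_u[OF t] C_\<phi>[OF t]
        noise_div_free[OF t]]
    show ?thesis
      by (simp add: depth_def mass_noise_def advect_def vcomp_def[abs_def] noise_div_free[OF t])
  qed
  have "AE \<omega> in M. E t \<omega> = E 0 \<omega>" if "t \<in> I" for t
    unfolding E_def
  proof (rule has_strat_differential_zero[OF M energy_differential[OF M calc solution] that])
    show "t \<ge> 0" using that time by auto
    show "{0..t} \<subseteq> I" using mem_is_interval_1_I[OF time(1,2) that] by auto
  qed (fact drift noise)+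
  moreover have "continuous_on I (\<lambda>t. E t \<omega>)" if "\<omega> \<in> space M" for \<omega>
  proof -
    have [continuous_intros]: "continuous_on (I \<times> cbox a b) (\<lambda>p. \<eta> (fst p) \<omega> (snd p))"
      "continuous_on (I \<times> cbox a b) (\<lambda>p. u (fst p) \<omega> (snd p) $ j)" for j
      using \<eta> u[of j] that unfolding smooth_semimartingale_field_def
      by (auto dest!: spec[of _ "[]"] bspec simp: vcomp_def split_def
          intro: continuous_on_subset[of "I \<times> UNIV"])
    have "continuous_on (I \<times> cbox a b)
        (\<lambda>(t, x). energy_density \<epsilon> (depth \<epsilon> \<eta> t \<omega> x) (u t \<omega> x))"
      by (auto simp: energy_density_def depth_def split_def intro!: continuous_intros)
    then have "continuous_on I (\<lambda>t. integral (cbox a b)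
        (\<lambda>x. energy_density \<epsilon> (depth \<epsilon> \<eta> t \<omega> x) (u t \<omega> x)))"
      by (rule integral_continuous_on_param)
    moreover have "continuous_on (cbox a b)
        (\<lambda>x. energy_density \<epsilon> (depth \<epsilon> \<eta> t \<omega> x) (u t \<omega> x))" if "t \<in> I" for t
      using C1_periodicD(2)[OF C1_periodic_energy_density[where \<epsilon> = \<epsilon>,
            OF C_\<eta> C_u, OF that \<open>\<omega> \<in> space M\<close> that \<open>\<omega> \<in> space M\<close>]]
      unfolding depth_def by (rule continuous_on_subset) simp
    ultimately show ?thesis
      by (simp add: E_def set_lebesgue_integral_cbox cong: continuous_on_cong)
  qed
  ultimately have "AE \<omega> in M. \<forall>t\<in>I. E t \<omega> = E 0 \<omega>"
    by (rule AE_constant_on_interval)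
  with AE_space show ?thesis
  proof eventually_elim
    case (elim \<omega>)
    have eq: "SW_energy a b \<epsilon> \<eta> u t \<omega> = E t \<omega>" if "t \<in> I" for t
      unfolding E_def
    proof (rule SW_energy_eq)
      show "continuous_on (cbox a b) (\<eta> t \<omega>)"
        by (rule continuous_on_subset[OF C1_periodicD(2)[OF C_\<eta>[OF that elim(1)]] subset_UNIV])
      show "continuous_on (cbox a b) (vcomp j u t \<omega>)" for j
        unfolding vcomp_def[abs_def]
        by (rule continuous_on_subset[OF C1_periodicD(2)[OF C_u[OF that elim(1)]] subset_UNIV])
    qed
    show ?case
    proof
      fix t assume "t \<in> I"
      then show "SW_energy a b \<epsilon> \<eta> u t \<omega> = SW_energy a b \<epsilon> \<eta> u 0 \<omega>"
        using eq[OF \<open>t \<in> I\<close>] eq[OF time(2)] bspec[OF elim(2) \<open>t \<in> I\<close>] by (simp only:)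
    qed
  qed
qed

end
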